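(* Let $n,p$ be positive integers. The metric space $(\mathbb{H}^{n\times n\times p}_{++},\delta)$ is complete, where $\delta$ is the Riemannian distance of the metric $g_{\mathcal{P}}(\mathcal{X},\mathcal{Y})=\operatorname{tr}(\mathcal{P}^{-1}*\mathcal{X}*\mathcal{P}^{-1}*\mathcal{Y})$ on the manifold $\mathbb{H}^{n\times n\times p}_{++}$ of T-positive definite tensors.
   Context: A tensor $\mathcal{A}\in\mathbb{C}^{m\times n\times p}$ has frontal slices $A^{(1)},\dots,A^{(p)}\in\mathbb{C}^{m\times n}$. $\operatorname{bcirc}(\mathcal{A})\in\mathbb{C}^{mp\times np}$ is the block circulant matrix whose $(j,l)$ block is $A^{(((j-l)\bmod p)+1)}$ (first block column $A^{(1)},\dots,A^{(p)}$); $\operatorname{unfold}(\mathcal{A})$ is the block column $A^{(1)},\dots,A^{(p)}$, and $\operatorname{fold}$ is its inverse. The T-product is $\mathcal{A}*\mathcal{B}=\operatorname{fold}(\operatorname{bcirc}(\mathcal{A})\cdot\operatorname{unfold}(\mathcal{B}))$; inverses are with respect to $*$ and the identity tensor $\mathcal{I}_{n,p}$ (first frontal slice $I_n$, others zero). The T-conjugate transpose $\mathcal{A}^H$ has frontal slices $(A^{(1)})^H,(A^{(p)})^H,\dots,(A^{(2)})^H$. $\mathbb{H}^{n\times n\times p}$ is the real vector space of T-Hermitian tensors ($\mathcal{A}\in\mathbb{C}^{n\times n\times p}$, $\mathcal{A}^H=\mathcal{A}$). With $\langle\mathcal{A},\mathcal{B}\rangle=\sum_{i,j,k}\overline{a_{ijk}}b_{ijk}$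 and $\|\mathcal{A}\|=\sqrt{\langle\mathcal{A},\mathcal{A}\rangle}$, $\mathbb{H}^{n\times n\times p}_{++}$ is the set of T-positive definite tensors, i.e. $\mathcal{A}\in\mathbb{H}^{n\times n\times p}$ with $\langle\mathcal{X},\mathcal{A}*\mathcal{X}\rangle>0$ for all nonzero $\mathcal{X}\in\mathbb{C}^{n\times1\times p}$ (equivalently, $\operatorname{bcirc}(\mathcal{A})$ is Hermitian positive definite). It is an open convex cone in $\mathbb{H}^{n\times n\times p}$, hence a smooth manifold with tangent spaces $\mathbb{H}^{n\times n\times p}$. The trace is $\operatorname{tr}(\mathcal{A})=\operatorname{tr}(\operatorname{bcirc}(\mathcal{A}))$. The length with respect to $g$ of a piecewise smooth path $\gamma:[a,b]\to\mathbb{H}^{n\times n\times p}_{++}$ is $L(\gamma)=\int_a^b\sqrt{g_{\gamma(t)}(\gamma'(t),\gamma'(t))}\,dt=\sqrt p\int_a^b\|\gamma(t)^{-1/2}*\gamma'(t)*\gamma(t)^{-1/2}\|\,dt$ (where $\mathcal{P}^{-1/2}$ is the inverse of the unique T-positive definite square root of $\mathcal{P}$), and $\delta(\mathcal{A},\mathcal{B})=\inf\{L(\gamma)\mid\gamma\text{ a piecewise smooth path from }\mathcal{A}\text{ to }\mathcal{B}\}$. *)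

theory Defs
  imports "HOL-Analysis.Analysis" "HOL-Library.Complex_Order"
begin

text \<open>
  An \<open>m \<times> n \<times> p\<close> tensor over the complex numbers is an element of \<^typ>\<open>complex^'n^'m^'p\<close>, with
  \<open>m = CARD('m)\<close>, \<open>n = CARD('n)\<close>, \<open>p = CARD('p)\<close>: the outermost index selects the frontal
  slice, an \<open>m \<times> n\<close> matrix.  Since the frontal slices have to be numbered, \<open>'p\<close> is assumed to be
  linearly ordered; the numeral types provide such a \<open>'p\<close> for every \<open>p \<ge> 1\<close>.
  Numbering starts at 0, so that slice number \<open>r\<close> is the one conventionally called
  \<open>A\<^sup>(\<^sup>r\<^sup>+\<^sup>1\<^sup>)\<close>; slice numbers are read modulo \<open>p\<close>.
\<close>

definition slice_pos :: "'p::{finite,linorder} \<Rightarrow> nat" where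
  "slice_pos k = card {j. j < k}"

lemma bij_betw_slice_pos: "bij_betw slice_pos (UNIV :: 'p::{finite,linorder} set) {..<CARD('p)}"
proof -
  have mono: "slice_pos j < slice_pos k" if "j < k" for j k :: 'p
    unfolding slice_pos_def using that by (intro psubset_card_mono) auto
  have inj: "inj (slice_pos :: 'p \<Rightarrow> nat)"
    by (rule injI) (metis mono less_irrefl linorder_neqE)
  have "slice_pos k < CARD('p)" for k :: 'p
    unfolding slice_pos_def by (intro psubset_card_mono) auto
  then have "range (slice_pos :: 'p \<Rightarrow> nat) \<subseteq> {..<CARD('p)}" by auto
  moreover have "card (range (slice_pos :: 'p \<Rightarrow> nat)) = CARD('p)"
    using inj by (rule card_image)
  ultimately show ?thesis
    using inj by (simp add: bij_betw_def card_subset_eq)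
qed

definition slice :: "complex^'n^'m^'p::{finite,linorder} \<Rightarrow> int \<Rightarrow> complex^'n^'m" where
  "slice A r = A $ (THE k. int (slice_pos k) = r mod int CARD('p))"

lemma slice_slice_pos: "slice A (int (slice_pos k)) = A $ k"
  for A :: "complex^'n^'m^'p::{finite,linorder}"
proof -
  have "slice_pos k < CARD('p)"
    using bij_betw_slice_pos bij_betwE by blast
  moreover have "(THE j. slice_pos j = slice_pos k) = k"
    by (rule the_equality) (use bij_betw_slice_pos[where 'p='p] in \<open>auto simp: bij_betw_def inj_def\<close>)
  ultimately show ?thesis by (simp add: slice_def)
qed

text \<open>Rows and columns of block matrices are indexed by pairs (block number, index in the block).\<close>

definition bcirc :: "complex^'n^'m^'p::{finite,linorder} \<Rightarrow> complex^('p \<times> 'n)^('p \<times> 'm)" where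
  "bcirc A = (\<chi> r c. slice A (int (slice_pos (fst r)) - int (slice_pos (fst c))) $ snd r $ snd c)"

definition tunfold :: "complex^'n^'m^'p::{finite,linorder} \<Rightarrow> complex^'n^('p \<times> 'm)" where
  "tunfold A = (\<chi> r. A $ fst r $ snd r)"

definition tfold :: "complex^'n^('p \<times> 'm) \<Rightarrow> complex^'n^'m^'p::{finite,linorder}" where
  "tfold M = (\<chi> k i. M $ (k, i))"

definition tprod ::
  "complex^'n^'m^'p::{finite,linorder} \<Rightarrow> complex^'s^'n^'p::{finite,linorder} \<Rightarrow>
    complex^'s^'m^'p::{finite,linorder}" (infixl "\<star>" 70) where
  "A \<star> B = tfold (bcirc A ** tunfold B)"

definition tid :: "complex^'n^'n^'p::{finite,linorder}" where
  "tid = (\<chi> k. if slice_pos k = 0 then mat 1 else 0)"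

definition tinv :: "complex^'n^'n^'p::{finite,linorder} \<Rightarrow> complex^'n^'n^'p::{finite,linorder}" where
  "tinv A = (THE B. A \<star> B = tid \<and> B \<star> A = tid)"

definition conj_transpose :: "complex^'n^'m \<Rightarrow> complex^'m^'n" where
  "conj_transpose M = (\<chi> i j. cnj (M $ j $ i))"

definition tadjoint :: "complex^'n^'m^'p::{finite,linorder} \<Rightarrow> complex^'m^'n^'p::{finite,linorder}" where
  "tadjoint A = (\<chi> k. conj_transpose (slice A (- int (slice_pos k))))"

definition tinner ::
  "complex^'n^'m^'p::{finite,linorder} \<Rightarrow> complex^'n^'m^'p::{finite,linorder} \<Rightarrow> complex" where
  "tinner A B = (\<Sum>k\<in>UNIV. \<Sum>i\<in>UNIV. \<Sum>j\<in>UNIV. cnj (A $ k $ i $ j) * B $ k $ i $ j)"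

definition T_Hermitian :: "(complex^'n^'n^'p::{finite,linorder}) set" where
  "T_Hermitian = {A. tadjoint A = A}"

text \<open>For complex numbers, \<open>0 < z\<close> means that \<open>z\<close> is real and positive.\<close>

definition T_pos_def :: "(complex^'n^'n^'p::{finite,linorder}) set" where
  "T_pos_def =
    {A \<in> T_Hermitian. \<forall>X :: complex^1^'n^'p::{finite,linorder}. X \<noteq> 0 \<longrightarrow> 0 < tinner X (A \<star> X)}"

definition ttrace :: "complex^'n^'n^'p::{finite,linorder} \<Rightarrow> complex" where
  "ttrace A = trace (bcirc A)"

text \<open>
  The trace below is a real number whenever \<open>P\<close> is T-positive definite and \<open>X\<close>, \<open>Y\<close> are
  T-Hermitian; \<^const>\<open>Re\<close> only converts it to type \<^typ>\<open>real\<close>.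
\<close>

definition riem_metric ::
  "complex^'n^'n^'p::{finite,linorder} \<Rightarrow> complex^'n^'n^'p::{finite,linorder} \<Rightarrow>
    complex^'n^'n^'p::{finite,linorder} \<Rightarrow> real" where
  "riem_metric P X Y = Re (ttrace (tinv P \<star> X \<star> tinv P \<star> Y))"

text \<open>
  Smoothness (of class \<open>C\<^sup>\<infinity>\<close>) on a compact interval, with one-sided derivatives at the
  end points; \<open>D k\<close> is the \<open>k\<close>-th derivative.
\<close>

definition smooth_on_Icc :: "(real \<Rightarrow> 'a::real_normed_vector) \<Rightarrow> real \<Rightarrow> real \<Rightarrow> bool" where
  "smooth_on_Icc \<gamma> a b \<longleftrightarrow>
    (\<exists>D :: nat \<Rightarrow> real \<Rightarrow> 'a. (\<forall>t\<in>{a..b}. D 0 t = \<gamma> t) \<and>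
      (\<forall>k. \<forall>t\<in>{a..b}. (D k has_vector_derivative D (Suc k) t) (at t within {a..b})))"

text \<open>
  \<^const>\<open>piecewise_C1_differentiable_on\<close> is not suitable here: it does not bound the derivative
  near the break points, and a path of infinite length would have a non-integrable speed, whose
  \<^const>\<open>integral\<close> is 0.
\<close>

definition piecewise_smooth_on_Icc ::
  "(real \<Rightarrow> 'a::real_normed_vector) \<Rightarrow> real \<Rightarrow> real \<Rightarrow> bool" where
  "piecewise_smooth_on_Icc \<gamma> a b \<longleftrightarrow>
    (\<exists>(m::nat) s. s 0 = a \<and> s m = b \<and>
      (\<forall>i<m. s i < s (Suc i) \<and> smooth_on_Icc \<gamma> (s i) (s (Suc i))))"

text \<open>At the finitely many break points, the value of the integrand is irrelevant.\<close>

definition riem_length ::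
  "(real \<Rightarrow> complex^'n^'n^'p::{finite,linorder}) \<Rightarrow> real \<Rightarrow> real \<Rightarrow> real" where
  "riem_length \<gamma> a b = integral {a..b} (\<lambda>t.
    sqrt (riem_metric (\<gamma> t) (vector_derivative \<gamma> (at t)) (vector_derivative \<gamma> (at t))))"

text \<open>The value 0 outside the manifold is a dummy, as required by the locale \<^locale>\<open>Metric_space\<close>.\<close>

definition riem_dist ::
  "complex^'n^'n^'p::{finite,linorder} \<Rightarrow> complex^'n^'n^'p::{finite,linorder} \<Rightarrow> real" where
  "riem_dist A B =
    (if A \<in> T_pos_def \<and> B \<in> T_pos_def
     then Inf {riem_length \<gamma> a b | \<gamma> a b. a < b \<and> piecewise_smooth_on_Icc \<gamma> a b \<and>
                 \<gamma> ` {a..b} \<subseteq> T_pos_def \<and> \<gamma> a = A \<and> \<gamma> b = B}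
     else 0)"

end

theory Submission
  imports Defs
begin

text \<open>
  Identifying a tensor \<open>A\<close> with its block circulant matrix turns the T-product into the matrix product
  (\<open>bcirc_tprod\<close>), T-positive definite tensors into Hermitian positive definite matrices
  (\<open>T_pos_def_iff\<close>) and the metric into the affine-invariant metric \<open>tr (P\<^sup>-\<^sup>1 X P\<^sup>-\<^sup>1 Y)\<close>.  The idea
  is to compare the distance with the quadratic forms \<open>q\<^sub>A(x) = x\<^sup>H A x\<close>.

  For a fixed nonzero \<open>x\<close>, the derivative of \<open>ln q\<^sub>P(x)\<close> along a path is at most its speed in absolute
  value: choosing \<open>C\<close> with \<open>P\<^sup>-\<^sup>1 = C C\<^sup>H\<close>, the squared speed is the squared Frobenius norm of \<open>C\<^sup>H P' C\<close>,
  and this dominates the quotient of the two forms (\<open>qform_le_affine_metric\<close>).  Hence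
  \<open>\<bar>ln q\<^sub>A(x) - ln q\<^sub>B(x)\<bar>\<close> is at most the distance of \<open>A\<close> and \<open>B\<close>, uniformly in \<open>x\<close>
  (\<open>ln_qform_le_riem_dist\<close>).  Conversely, if \<open>\<bar>q\<^sub>A - q\<^sub>B\<bar>\<close> is at most \<open>\<eta> q\<^sub>A\<close> and at most \<open>\<eta> q\<^sub>B\<close>, the segment
  from \<open>A\<close> to \<open>B\<close> has length at most \<open>n p \<eta>\<close> (\<open>riem_dist_le_of_qform\<close>).

  The lower bound separates points; the remaining metric axioms come from reversing and joining paths.
  It also shows that the forms of a Cauchy sequence are uniformly close in relative terms.  By
  polarization the entries then converge; the limit is positive definite since its form is relatively
  close to the late ones; and the upper bound gives convergence in the distance.
\<close>

section \<open>Sesquilinear and quadratic forms of complex matrices\<close>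

definition hform :: "complex^'N^'N \<Rightarrow> complex^'N \<Rightarrow> complex^'N \<Rightarrow> complex" where
  "hform M x y = (\<Sum>i\<in>UNIV. \<Sum>j\<in>UNIV. cnj (x $ i) * M $ i $ j * y $ j)"

definition qform :: "complex^'N^'N \<Rightarrow> complex^'N \<Rightarrow> real" where
  "qform M x = Re (hform M x x)"

lemma hform_add: "hform (M + M') x y = hform M x y + hform M' x y"
  and hform_diff: "hform (M - M') x y = hform M x y - hform M' x y"
  and hform_scaleR: "hform (r *\<^sub>R M) x y = of_real r * hform M x y"
  unfolding hform_def
  by (simp_all add: algebra_simps sum.distrib sum_subtractf sum_distrib_left
      scaleR_conv_of_real[where 'a=complex])

lemma hform_add_left: "hform M (x + x') y = hform M x y + hform M x' y"
  and hform_add_right: "hform M x (y + y') = hform M x y + hform M x y'"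
  and hform_diff_left: "hform M (x - x') y = hform M x y - hform M x' y"
  and hform_diff_right: "hform M x (y - y') = hform M x y - hform M x y'"
  and hform_mult_left: "hform M (c *s x) y = cnj c * hform M x y"
  and hform_mult_right: "hform M x (c *s y) = c * hform M x y"
  unfolding hform_def
  by (simp_all add: algebra_simps sum.distrib sum_subtractf sum_distrib_left)

lemma hform_zero [simp]: "hform M 0 y = 0" "hform M x 0 = 0"
  by (simp_all add: hform_def)

lemma hform_axis_left: "hform M (axis i 1) y = (\<Sum>j\<in>UNIV. M $ i $ j * y $ j)"
proof -
  have "hform M (axis i 1) y = (\<Sum>k\<in>UNIV. if k = i then \<Sum>j\<in>UNIV. M $ i $ j * y $ j else 0)"
    unfolding hform_def by (intro sum.cong) (auto simp: axis_def)
  then show ?thesis by simp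
qed

lemma hform_axis_axis: "hform M (axis i 1) (axis j 1) = M $ i $ j"
proof -
  have "hform M (axis i 1) (axis j 1) = (\<Sum>k\<in>UNIV. if k = j then M $ i $ j else 0)"
    unfolding hform_axis_left by (intro sum.cong) (auto simp: axis_def)
  then show ?thesis by simp
qed

lemma hform_mult_vec_right: "hform M x (A *v y) = hform (M ** A) x y"
proof -
  have "hform M x (A *v y) = (\<Sum>i\<in>UNIV. \<Sum>k\<in>UNIV. \<Sum>j\<in>UNIV. cnj (x $ i) * M $ i $ k * (A $ k $ j * y $ j))"
    by (simp add: hform_def matrix_vector_mult_def sum_distrib_left)
  also have "\<dots> = (\<Sum>i\<in>UNIV. \<Sum>j\<in>UNIV. \<Sum>k\<in>UNIV. cnj (x $ i) * M $ i $ k * (A $ k $ j * y $ j))"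
    by (intro sum.cong refl sum.swap)
  also have "\<dots> = hform (M ** A) x y"
    by (simp add: hform_def matrix_matrix_mult_def sum_distrib_left sum_distrib_right mult.assoc)
  finally show ?thesis .
qed

lemma hform_conj_transpose: "hform (conj_transpose M) y x = cnj (hform M x y)"
  unfolding hform_def conj_transpose_def
  by (subst sum.swap) (simp add: mult_ac)

lemma conj_transpose_conj_transpose [simp]: "conj_transpose (conj_transpose M) = M"
  by (simp add: conj_transpose_def vec_eq_iff)

lemma conj_transpose_mult: "conj_transpose (A ** B) = conj_transpose B ** conj_transpose A"
  by (simp add: conj_transpose_def matrix_matrix_mult_def vec_eq_iff mult.commute)

lemma hform_mult_vec_left: "hform M (A *v x) y = hform (conj_transpose A ** M) x y"
proof -
  have "hform M (A *v x) y = cnj (hform (conj_transpose M) y (A *v x))"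
    by (simp flip: hform_conj_transpose)
  also have "\<dots> = hform (conj_transpose (conj_transpose M ** A)) x y"
    by (simp add: hform_mult_vec_right hform_conj_transpose)
  finally show ?thesis by (simp add: conj_transpose_mult)
qed

lemma hform_mat1: "hform (mat 1) x x = of_real ((norm x)\<^sup>2)"
proof -
  have "hform (mat 1) x x = (\<Sum>i\<in>UNIV. \<Sum>j\<in>UNIV. if j = i then cnj (x $ i) * x $ i else 0)"
    unfolding hform_def by (intro sum.cong) (auto simp: mat_def)
  also have "\<dots> = (\<Sum>i\<in>UNIV. of_real ((norm (x $ i))\<^sup>2))"
    by (simp add: complex_norm_square mult.commute del: of_real_power)
  finally show ?thesis
    by (simp add: norm_vec_def L2_set_def sum_nonneg)
qed

lemma qform_zero [simp]: "qform M 0 = 0"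
  by (simp add: qform_def)

lemma qform_add: "qform (M + M') x = qform M x + qform M' x"
  and qform_diff: "qform (M - M') x = qform M x - qform M' x"
  and qform_scaleR: "qform (r *\<^sub>R M) x = r * qform M x"
  by (simp_all add: qform_def hform_add hform_diff hform_scaleR)

lemma qform_mat1: "qform (mat 1) x = (norm x)\<^sup>2"
  by (simp add: qform_def hform_mat1 del: of_real_power)

definition hermitian :: "complex^'N^'N \<Rightarrow> bool" where
  "hermitian M \<longleftrightarrow> conj_transpose M = M"

lemma hermitian_entry: "hermitian M \<Longrightarrow> M $ j $ i = cnj (M $ i $ j)"
  unfolding hermitian_def conj_transpose_def vec_eq_iff by simp

lemma hermitian_hform: "hermitian M \<Longrightarrow> hform M y x = cnj (hform M x y)"
  by (metis hform_conj_transpose hermitian_def)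

lemma hermitian_diff: "hermitian M \<Longrightarrow> hermitian M' \<Longrightarrow> hermitian (M - M')"
  by (simp add: hermitian_def conj_transpose_def vec_eq_iff)

text \<open>
  Polarization: if \<open>z\<close> has modulus at most 1 and turns the entry \<open>M\<^sub>i\<^sub>j\<close> into its modulus, then the forms
  at \<open>e\<^sub>i + z e\<^sub>j\<close> and \<open>e\<^sub>i - z e\<^sub>j\<close> differ by four times that modulus, while by the parallelogram law the
  squared norms of these vectors add up to at most 4.  Thus a Hermitian matrix is controlled by its quadratic form, so
  that uniform closeness of forms gives closeness of entries.
\<close>

lemma hermitian_entry_bound:
  assumes "hermitian M" and bd: "\<And>x. \<bar>qform M x\<bar> \<le> \<eta> * (norm x)\<^sup>2"
  shows "norm (M $ i $ j) \<le> \<eta>"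
proof -
  define z where "z = cnj (sgn (M $ i $ j))"
  let ?a = "axis i 1 :: complex^'a" and ?b = "z *s axis j 1 :: complex^'a"
  have z: "z * M $ i $ j = of_real (norm (M $ i $ j))"
  proof -
    have "z * M $ i $ j = of_real ((norm (M $ i $ j))\<^sup>2) / of_real (norm (M $ i $ j))"
      unfolding z_def sgn_eq complex_norm_square by (simp add: mult_ac)
    then show ?thesis by (simp add: power2_eq_square)
  qed
  have "hform M ?b ?a = cnj (hform M ?a ?b)"
    by (rule hermitian_hform[OF assms(1)])
  moreover have "hform M ?a ?b = of_real (norm (M $ i $ j))"
    by (simp add: hform_mult_right hform_axis_axis z)
  ultimately have "qform M (?a + ?b) - qform M (?a - ?b) = 4 * norm (M $ i $ j)"
    by (simp add: qform_def hform_add_left hform_add_right hform_diff_left hform_diff_right)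
  moreover have "(norm (?a + ?b))\<^sup>2 + (norm (?a - ?b))\<^sup>2 = 2 * (norm ?a)\<^sup>2 + 2 * (norm ?b)\<^sup>2"
    by (simp add: power2_norm_eq_inner inner_simps inner_commute)
  moreover have "norm ?a = 1" "norm ?b \<le> 1"
  proof -
    show "norm ?a = 1" by simp
    have "(norm ?b)\<^sup>2 = (norm z)\<^sup>2"
      unfolding qform_mat1[symmetric] qform_def hform_mult_left hform_mult_right hform_axis_axis
      by (simp add: mat_def cmod_power2 flip: power2_eq_square)
    then have "norm ?b = norm z" by simp
    then show "norm ?b \<le> 1" by (simp add: z_def norm_sgn)
  qed
  moreover have "(norm ?b)\<^sup>2 \<le> 1" using calculation(4) by (simp add: power_le_one)
  moreover have "0 \<le> \<eta>"
    using bd[of ?a] by simp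
  moreover define u v where "u = (norm (?a + ?b))\<^sup>2" and "v = (norm (?a - ?b))\<^sup>2"
  ultimately have "u + v \<le> 4" "4 * norm (M $ i $ j) \<le> \<eta> * u + \<eta> * v" "0 \<le> \<eta>"
    using bd[of "?a + ?b"] bd[of "?a - ?b"] by simp_all
  then have "4 * norm (M $ i $ j) \<le> \<eta> * 4"
    using mult_left_mono[of "u + v" 4 \<eta>] by (simp add: distrib_left)
  then show ?thesis by simp
qed

text \<open>
  Cauchy--Schwarz over pairs of indices, for the family of entries \<open>M\<^sub>i\<^sub>j\<close> against the family of products
  \<open>x\<^sub>i x\<^sub>j\<close>.
\<close>

lemma qform_le_Frobenius:
  "\<bar>qform M x\<bar> \<le> sqrt (\<Sum>i\<in>UNIV. \<Sum>j\<in>UNIV. (norm (M $ i $ j))\<^sup>2) * (norm x)\<^sup>2"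
proof -
  let ?I = "UNIV \<times> UNIV :: ('a \<times> 'a) set"
  let ?m = "\<lambda>(i, j). norm (M $ i $ j)" and ?x = "\<lambda>(i, j). norm (x $ i) * norm (x $ j)"
  have "\<bar>qform M x\<bar> \<le> norm (hform M x x)"
    by (simp add: qform_def abs_Re_le_cmod)
  also have "hform M x x = (\<Sum>(i, j)\<in>?I. cnj (x $ i) * M $ i $ j * x $ j)"
    by (simp add: hform_def sum.cartesian_product)
  also have "norm \<dots> \<le> (\<Sum>p\<in>?I. \<bar>?m p\<bar> * \<bar>?x p\<bar>)"
    by (rule order_trans[OF norm_sum]) (auto intro!: sum_mono simp: norm_mult)
  also have "\<dots> \<le> L2_set ?m ?I * L2_set ?x ?I"
    by (rule L2_set_mult_ineq)
  also have "L2_set ?m ?I = sqrt (\<Sum>i\<in>UNIV. \<Sum>j\<in>UNIV. (norm (M $ i $ j))\<^sup>2)"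
    by (simp add: L2_set_def sum.cartesian_product case_prod_beta)
  also have "L2_set ?x ?I = (norm x)\<^sup>2"
  proof -
    have "(\<Sum>p\<in>?I. (?x p)\<^sup>2) = (\<Sum>i\<in>UNIV. (norm (x $ i))\<^sup>2) * (\<Sum>i\<in>UNIV. (norm (x $ i))\<^sup>2)"
      by (simp add: sum_product sum.cartesian_product case_prod_beta power_mult_distrib)
    then show ?thesis
      by (simp add: L2_set_def norm_vec_def real_sqrt_mult sum_nonneg)
  qed
  finally show ?thesis .
qed

section \<open>Positive semidefinite matrices as Gram matrices\<close>

text \<open>
  Symmetric Gaussian elimination.  If \<open>M\<^sub>i\<^sub>i > 0\<close>, subtracting the rank-one matrix built from column \<open>i\<close>
  clears that column and keeps the form nonnegative, because the new form at \<open>x\<close> is the old form at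
  the projection of \<open>x\<close> along \<open>e\<^sub>i\<close> onto the complement of \<open>e\<^sub>i\<close> that is orthogonal with respect to \<open>M\<close>.
  The set \<open>S\<close> records the columns that are still to be cleared; once the diagonal vanishes, a
  nonnegative form vanishes altogether.
\<close>

lemma psd_sum_rank_one:
  fixes M :: "complex^'N^'N"
  assumes "finite S" "hermitian M" "\<And>x. 0 \<le> qform M x" "\<And>i. i \<notin> S \<Longrightarrow> M $ i $ i = 0"
  shows "\<exists>c :: 'N \<Rightarrow> complex^'N. \<forall>j k. M $ j $ k = (\<Sum>i\<in>S. c i $ j * cnj (c i $ k))"
  using assms
proof (induction S arbitrary: M rule: finite_induct)
  case empty
  have "M $ j $ k = 0" for j k
  proof -
    \<comment> \<open>This choice makes the cross term of the form equal to minus twice the squared modulus of the entry.\<close>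
    define z where "z = - cnj (M $ j $ k)"
    let ?a = "axis j 1 :: complex^'N" and ?b = "z *s axis k 1 :: complex^'N"
    have 1: "hform M ?b ?a = cnj (hform M ?a ?b)"
      by (rule hermitian_hform[OF empty(1)])
    have 2: "hform M ?a ?b = - of_real ((norm (M $ j $ k))\<^sup>2)"
      unfolding complex_norm_square by (simp only: hform_mult_right hform_axis_axis) (simp add: z_def mult.commute)
    have "hform M ?a ?a = 0" "hform M ?b ?b = 0"
      unfolding hform_mult_left hform_mult_right hform_axis_axis using empty(3) by simp_all
    then have "qform M (?a + ?b) = - 2 * (norm (M $ j $ k))\<^sup>2"
      using 1 2 by (simp add: qform_def hform_add_left hform_add_right del: of_real_power)
    then show ?thesis using empty(2)[of "?a + ?b"] by simp
  qed
  then show ?case by simp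
next
  case (insert i S)
  have diag: "M $ j $ j = of_real (qform M (axis j 1))" for j
    using hermitian_entry[OF insert.prems(1), of j j]
    by (simp add: qform_def hform_axis_axis complex_eq_iff)
  define d where "d = qform M (axis i 1)"
  have d: "M $ i $ i = of_real d" "0 \<le> d"
    using diag insert.prems(2) by (auto simp: d_def)
  show ?case
  proof (cases "d = 0")
    case True
    then have "\<exists>c :: 'N \<Rightarrow> complex^'N. \<forall>j k. M $ j $ k = (\<Sum>i\<in>S. c i $ j * cnj (c i $ k))"
      using insert.prems d by (intro insert.IH) (auto, metis)
    then obtain c :: "'N \<Rightarrow> complex^'N"
      where c: "M $ j $ k = (\<Sum>i\<in>S. c i $ j * cnj (c i $ k))" for j k by auto
    have "(\<Sum>l\<in>S. (c(i := 0)) l $ j * cnj ((c(i := 0)) l $ k)) = (\<Sum>l\<in>S. c l $ j * cnj (c l $ k))" for j k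
      using insert.hyps by (intro sum.cong) auto
    with c insert.hyps show ?thesis by (intro exI[of _ "c(i := 0)"]) simp
  next
    case False
    with d have dpos: "0 < d" by simp
    define M' where "M' = (\<chi> j k. M $ j $ k - M $ j $ i * M $ i $ k / of_real d)"
    have herm: "M $ j $ k = cnj (M $ k $ j)" for j k
      by (rule hermitian_entry[OF insert.prems(1)])
    have "hermitian M'"
      unfolding hermitian_def
      by (simp add: conj_transpose_def M'_def vec_eq_iff) (metis herm mult.commute)
    moreover have psd: "0 \<le> qform M' x" for x
    proof -
      let ?e = "axis i 1 :: complex^'N"
      define h where "h = hform M ?e x"
      \<comment> \<open>Subtracting \<open>\<alpha> e\<^sub>i\<close> projects \<open>x\<close> onto the complement of \<open>e\<^sub>i\<close> orthogonal for \<open>M\<close>.\<close>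
      define \<alpha> where "\<alpha> = h / of_real d"
      have h': "hform M x ?e = cnj h"
        unfolding h_def by (rule hermitian_hform[OF insert.prems(1)])
      have hx: "cnj h = (\<Sum>j\<in>UNIV. cnj (x $ j) * M $ j $ i)"
        unfolding h_def hform_axis_left by (simp add: mult.commute flip: herm)
      have "hform M' x x = hform M x x - (\<Sum>j\<in>UNIV. \<Sum>k\<in>UNIV. (cnj (x $ j) * M $ j $ i) * (M $ i $ k * x $ k)) / of_real d"
        unfolding hform_def M'_def
        by (simp add: algebra_simps sum_subtractf sum_divide_distrib)
      also have "\<dots> = hform M x x - cnj h * h / of_real d"
        unfolding hx unfolding h_def hform_axis_left by (simp add: sum_product)
      also have "\<dots> = hform M (x - \<alpha> *s ?e) (x - \<alpha> *s ?e)"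
        using dpos
        by (simp add: hform_diff_left hform_diff_right hform_mult_left hform_mult_right
            hform_axis_axis h' d \<alpha>_def field_simps flip: h_def)
      finally show ?thesis using insert.prems(2) by (simp add: qform_def)
    qed
    moreover have "M' $ j $ j = 0" if "j \<notin> S" for j
    proof (cases "j = i")
      case True
      then show ?thesis using d dpos by (simp add: M'_def)
    next
      case False
      then have "M $ j $ j = 0" using insert.prems(3) that by simp
      then have *: "M' $ j $ j = - of_real ((norm (M $ j $ i))\<^sup>2 / d)"
        unfolding of_real_divide complex_norm_square M'_def using herm[of i j] by simp
      \<comment> \<open>Elimination can only lower a diagonal entry, so an entry that is already zero stays zero.\<close>
      have "0 \<le> Re (M' $ j $ j)"
        using psd[of "axis j 1"] by (simp add: qform_def hform_axis_axis)
      then have "(norm (M $ j $ i))\<^sup>2 / d \<le> 0" unfolding * by simp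
      with dpos have "(norm (M $ j $ i))\<^sup>2 / d = 0"
        by (intro antisym) auto
      with * show ?thesis by simp
    qed
    ultimately have "\<exists>c :: 'N \<Rightarrow> complex^'N. \<forall>j k. M' $ j $ k = (\<Sum>i\<in>S. c i $ j * cnj (c i $ k))"
      by (intro insert.IH)
    then obtain c :: "'N \<Rightarrow> complex^'N"
      where c: "M' $ j $ k = (\<Sum>i\<in>S. c i $ j * cnj (c i $ k))" for j k by auto
    define c' where "c' = c(i := (\<chi> j. M $ j $ i / of_real (sqrt d)))"
    have "(\<Sum>l\<in>insert i S. c' l $ j * cnj (c' l $ k)) = M $ j $ k" for j k
    proof -
      have "(\<Sum>l\<in>S. c' l $ j * cnj (c' l $ k)) = M' $ j $ k"
        unfolding c using insert.hyps by (intro sum.cong) (auto simp: c'_def)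
      moreover have "c' i $ j * cnj (c' i $ k) = M $ j $ i * M $ i $ k / of_real d"
      proof -
        have "complex_of_real (sqrt d) * of_real (sqrt d) = of_real d"
          unfolding of_real_mult[symmetric] using dpos by simp
        then show ?thesis by (simp add: c'_def flip: herm)
      qed
      ultimately show ?thesis
        using insert.hyps by (simp add: M'_def)
    qed
    then show ?thesis by metis
  qed
qed

lemma psd_imp_gram:
  fixes M :: "complex^'N^'N"
  assumes "hermitian M" "\<And>x. 0 \<le> qform M x"
  obtains C :: "complex^'N^'N" where "M = C ** conj_transpose C"
proof -
  obtain c :: "'N \<Rightarrow> complex^'N"
    where c: "\<forall>j k. M $ j $ k = (\<Sum>i\<in>UNIV. c i $ j * cnj (c i $ k))"
    using psd_sum_rank_one[of UNIV M] assms by auto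
  show thesis
    by (rule that[of "\<chi> j i. c i $ j"])
      (simp add: c vec_eq_iff matrix_matrix_mult_def conj_transpose_def)
qed

definition pos_def :: "complex^'N^'N \<Rightarrow> bool" where
  "pos_def M \<longleftrightarrow> hermitian M \<and> (\<forall>x. x \<noteq> 0 \<longrightarrow> 0 < qform M x)"

section \<open>The affine-invariant metric on positive definite matrices\<close>

lemma matrix_inv_mult:
  fixes A :: "'a::field^'N^'N"
  assumes "invertible A"
  shows "A ** matrix_inv A = mat 1" "matrix_inv A ** A = mat 1"
proof -
  have "A ** matrix_inv A = mat 1 \<and> matrix_inv A ** A = mat 1"
    unfolding matrix_inv_def by (rule someI_ex) (use assms in \<open>simp add: invertible_def\<close>)
  then show "A ** matrix_inv A = mat 1" "matrix_inv A ** A = mat 1" by auto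
qed

lemma matrix_inv_eqI:
  fixes A :: "'a::field^'N^'N"
  assumes "A ** B = mat 1"
  shows "matrix_inv A = B"
proof -
  have "invertible A" using assms by (auto simp: invertible_right_inverse)
  then show ?thesis
    by (metis assms matrix_inv_mult(2) matrix_mul_assoc matrix_mul_lid matrix_mul_rid)
qed

lemma pos_def_invertible:
  assumes "pos_def M" shows "invertible M"
proof -
  have "x = 0" if "M *v x = 0" for x
  proof (rule ccontr)
    assume "x \<noteq> 0"
    moreover have "hform M x x = hform (mat 1) x (M *v x)"
      by (simp add: hform_mult_vec_right)
    ultimately show False
      using assms that by (auto simp: pos_def_def qform_def)
  qed
  then have "\<exists>B. B ** M = mat 1"
    by (simp add: matrix_left_invertible_ker)
  then show ?thesis by (simp add: invertible_left_inverse)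
qed

text \<open>
  The columns of \<open>C\<close> form a basis that is orthonormal for the inner product given by \<open>P\<close>.  In the
  coordinates of this basis \<open>P\<close> becomes the identity, so that comparing a Hermitian matrix with \<open>P\<close>
  becomes comparing it with the identity.
\<close>

lemma pos_def_inverse_gram:
  fixes P :: "complex^'N^'N"
  assumes "pos_def P"
  obtains C :: "complex^'N^'N"
  where "matrix_inv P = C ** conj_transpose C" "conj_transpose C ** P ** C = mat 1"
proof -
  let ?Q = "matrix_inv P"
  have h: "conj_transpose P = P" using assms by (simp add: pos_def_def hermitian_def)
  have inv: "?Q ** P = mat 1" "P ** ?Q = mat 1"
    using pos_def_invertible[OF assms] by (simp_all add: matrix_inv_mult)
  have m1: "conj_transpose (mat 1) = (mat 1 :: complex^'N^'N)"
    by (auto simp: conj_transpose_def mat_def vec_eq_iff)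
  have "conj_transpose ?Q ** P = mat 1"
    using arg_cong[OF inv(2), of conj_transpose] by (simp add: conj_transpose_mult h m1)
  then have hQ: "conj_transpose ?Q = ?Q"
    by (metis inv(2) matrix_mul_assoc matrix_mul_lid matrix_mul_rid)
  have "qform ?Q x = qform P (?Q *v x)" for x
    by (simp add: qform_def hform_mult_vec_left hform_mult_vec_right hQ inv matrix_mul_assoc)
  moreover have "0 \<le> qform P x" for x
    using assms by (cases "x = 0") (auto simp: pos_def_def less_imp_le)
  ultimately have "0 \<le> qform ?Q x" for x
    by simp
  moreover have "hermitian ?Q"
    using hQ by (simp add: hermitian_def)
  ultimately obtain C :: "complex^'N^'N" where C: "?Q = C ** conj_transpose C"
    using psd_imp_gram[of ?Q] by blast
  have "C ** (conj_transpose C ** P) = mat 1"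
    using inv(1) by (simp add: C matrix_mul_assoc)
  then have "(conj_transpose C ** P) ** C = mat 1"
    by (simp add: matrix_left_right_inverse)
  with C show thesis by (rule that)
qed

definition affine_metric :: "complex^'N^'N \<Rightarrow> complex^'N^'N \<Rightarrow> real" where
  "affine_metric P H = Re (trace (matrix_inv P ** H ** matrix_inv P ** H))"

text \<open>
  In the coordinates that turn \<open>P\<close> into the identity, the metric at \<open>P\<close> is the squared Frobenius norm.
\<close>

lemma affine_metric_eq_Frobenius:
  assumes "matrix_inv P = C ** conj_transpose C" "hermitian H"
  defines "S \<equiv> conj_transpose C ** H ** C"
  shows "affine_metric P H = (\<Sum>i\<in>UNIV. \<Sum>j\<in>UNIV. (norm (S $ i $ j))\<^sup>2)"
proof -
  have "hermitian S"
    using assms(2) by (simp add: S_def hermitian_def conj_transpose_mult matrix_mul_assoc)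
  have "trace (matrix_inv P ** H ** matrix_inv P ** H) = trace (C ** (conj_transpose C ** H ** C ** conj_transpose C ** H))"
    by (simp add: assms(1) matrix_mul_assoc)
  also have "\<dots> = trace (S ** S)"
    by (subst trace_mul_sym) (simp add: S_def matrix_mul_assoc)
  also have "\<dots> = (\<Sum>i\<in>UNIV. \<Sum>j\<in>UNIV. of_real ((norm (S $ i $ j))\<^sup>2))"
    unfolding complex_norm_square hermitian_entry[OF \<open>hermitian S\<close>, symmetric]
    by (simp add: trace_def matrix_matrix_mult_def)
  finally show ?thesis
    by (simp add: affine_metric_def del: of_real_power)
qed

text \<open>
  This is the source of every lower bound on lengths: along a path \<open>P\<close> with derivative \<open>H\<close>, it bounds the
  logarithmic derivative of \<open>x\<^sup>H P x\<close> by the speed.  It is the Frobenius bound in the coordinates that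
  turn \<open>P\<close> into the identity.
\<close>

lemma qform_le_affine_metric:
  fixes P H :: "complex^'N^'N"
  assumes "pos_def P" "hermitian H"
  shows "\<bar>qform H x\<bar> \<le> sqrt (affine_metric P H) * qform P x"
proof -
  obtain C :: "complex^'N^'N" where C: "matrix_inv P = C ** conj_transpose C" "conj_transpose C ** P ** C = mat 1"
    using pos_def_inverse_gram[OF assms(1)] .
  let ?S = "conj_transpose C ** H ** C"
  define y where "y = (conj_transpose C ** P) *v x"
  have "C ** (conj_transpose C ** P) = mat 1"
    using C(2) by (simp add: matrix_left_right_inverse)
  then have x: "x = C *v y"
    by (simp add: y_def matrix_vector_mul_assoc)
  have "qform H x = qform ?S y" and "qform P x = (norm y)\<^sup>2"
    by (simp_all add: x qform_def hform_mult_vec_left hform_mult_vec_right matrix_mul_assoc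
        C(2) hform_mat1 del: of_real_power)
  then show ?thesis
    using qform_le_Frobenius[of ?S y] affine_metric_eq_Frobenius[OF C(1) assms(2)] by simp
qed

text \<open>
  The converse estimate, for upper bounds on lengths: in the coordinates that turn \<open>P\<close> into the
  identity, every entry of \<open>H\<close> has modulus at most \<open>\<eta>\<close>.
\<close>

lemma affine_metric_le:
  fixes P H :: "complex^'N^'N" and \<eta> :: real
  assumes "pos_def P" "hermitian H" and le: "\<And>x. \<bar>qform H x\<bar> \<le> \<eta> * qform P x"
  shows "sqrt (affine_metric P H) \<le> CARD('N) * \<eta>"
proof -
  obtain C :: "complex^'N^'N" where C: "matrix_inv P = C ** conj_transpose C" "conj_transpose C ** P ** C = mat 1"
    using pos_def_inverse_gram[OF assms(1)] .
  let ?S = "conj_transpose C ** H ** C"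
  have herm: "hermitian ?S"
    using assms(2) by (simp add: hermitian_def conj_transpose_mult matrix_mul_assoc)
  have S: "qform ?S y = qform H (C *v y)" and n: "(norm y)\<^sup>2 = qform P (C *v y)" for y
    by (simp_all add: qform_def hform_mult_vec_left hform_mult_vec_right matrix_mul_assoc
        C(2) hform_mat1 del: of_real_power)
  have bd: "norm (?S $ i $ j) \<le> \<eta>" for i j
    by (rule hermitian_entry_bound[OF herm]) (unfold S n, rule le)
  have "0 \<le> \<eta>" using order_trans[OF norm_ge_zero bd] .
  have "affine_metric P H \<le> (\<Sum>(i::'N)\<in>UNIV. \<Sum>(j::'N)\<in>UNIV. \<eta>\<^sup>2)"
    unfolding affine_metric_eq_Frobenius[OF C(1) assms(2)]
    by (intro sum_mono power_mono bd) auto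
  also have "\<dots> = (CARD('N) * \<eta>)\<^sup>2"
    by (simp add: power2_eq_square)
  finally have "affine_metric P H \<le> (CARD('N) * \<eta>)\<^sup>2" .
  then show ?thesis
    by (intro real_le_lsqrt) (use \<open>0 \<le> \<eta>\<close> in auto)
qed

section \<open>Tensors as block circulant matrices\<close>

definition slice_idx :: "int \<Rightarrow> 'p::{finite,linorder}" where
  "slice_idx r = (THE k. int (slice_pos k) = r mod int CARD('p))"

lemma slice_eq: "slice A r = A $ slice_idx r"
  by (simp add: slice_def slice_idx_def)

lemma slice_pos_less: "slice_pos (k :: 'p::{finite,linorder}) < CARD('p)"
  using bij_betw_slice_pos bij_betwE by blast

lemma slice_pos_eq_iff [simp]: "slice_pos j = slice_pos k \<longleftrightarrow> j = k"
  using bij_betw_slice_pos[where 'p='a] by (auto simp: bij_betw_def inj_eq)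

lemma slice_pos_slice_idx: "int (slice_pos (slice_idx r :: 'p)) = r mod int CARD('p::{finite,linorder})"
proof -
  have "nat (r mod int CARD('p)) \<in> {..<CARD('p)}"
    by (simp add: nat_less_iff)
  then obtain k :: 'p where "slice_pos k = nat (r mod int CARD('p))"
    using bij_betw_slice_pos[where 'p='p] by (metis bij_betw_def imageE)
  then have "int (slice_pos k) = r mod int CARD('p)" by simp
  then show ?thesis unfolding slice_idx_def
    by (rule theI[where P = "\<lambda>k::'p. int (slice_pos k) = r mod int CARD('p)"])
      (metis \<open>int (slice_pos k) = r mod int CARD('p)\<close> of_nat_eq_iff slice_pos_eq_iff)
qed

lemma slice_idx_cong:
  assumes "r mod int CARD('p) = s mod int CARD('p)"
  shows "slice_idx r = (slice_idx s :: 'p::{finite,linorder})"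
  using assms by (simp add: slice_idx_def)

lemma slice_idx_eqI:
  assumes "r mod int CARD('p) = int (slice_pos k)"
  shows "slice_idx r = (k :: 'p::{finite,linorder})"
  using assms by (metis of_nat_eq_iff slice_pos_eq_iff slice_pos_slice_idx)

lemma slice_idx_slice_pos [simp]: "slice_idx (int (slice_pos k)) = k"
  by (rule slice_idx_eqI) (simp add: slice_pos_less)

lemma bcirc_entry:
  "bcirc A $ (k, i) $ (l, j) = A $ slice_idx (int (slice_pos k) - int (slice_pos l)) $ i $ j"
  by (simp add: bcirc_def slice_eq)

lemma ex_slice_pos_0: "\<exists>z :: 'p::{finite,linorder}. slice_pos z = 0"
  using slice_pos_slice_idx[of 0, where 'p='p] by auto

lemma bcirc_first_column:
  "slice_pos z = 0 \<Longrightarrow> bcirc A $ (k, i) $ (z, j) = A $ k $ i $ j"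
  by (simp add: bcirc_entry)

lemma bcirc_inject: "bcirc A = bcirc B \<longleftrightarrow> A = B"
  for A B :: "complex^'n^'m^'p::{finite,linorder}"
proof
  assume eq: "bcirc A = bcirc B"
  obtain z :: 'p where "slice_pos z = 0" using ex_slice_pos_0 by auto
  then have "A $ k $ i $ j = B $ k $ i $ j" for k i j
    using eq bcirc_first_column[of z A k i j] bcirc_first_column[of z B k i j] by simp
  then show "A = B" by (simp add: vec_eq_iff)
qed simp

lemma bcirc_add: "bcirc (A + B) = bcirc A + bcirc B"
  and bcirc_diff: "bcirc (A - B) = bcirc A - bcirc B"
  and bcirc_scaleR: "bcirc (r *\<^sub>R A) = r *\<^sub>R bcirc A"
  by (simp_all add: bcirc_def slice_eq vec_eq_iff)

lemma bounded_linear_bcirc: "bounded_linear bcirc"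
  by (rule linear_conv_bounded_linear[THEN iffD1])
    (simp add: bcirc_add bcirc_scaleR linear_iff)

lemma tprod_entry:
  "(A \<star> B) $ k $ i $ j =
    (\<Sum>l\<in>UNIV. \<Sum>m\<in>UNIV. A $ slice_idx (int (slice_pos k) - int (slice_pos l)) $ i $ m * B $ l $ m $ j)"
  by (simp add: tprod_def tfold_def tunfold_def matrix_matrix_mult_def sum.cartesian_product
      case_prod_beta bcirc_entry[symmetric])

text \<open>
  Both sides are convolutions over the cyclic group of slice numbers; they differ by a translation of
  the summation index.
\<close>

lemma bcirc_tprod: "bcirc (A \<star> B) = bcirc A ** bcirc B"
  for A :: "complex^'n^'m^'p::{finite,linorder}" and B :: "complex^'s^'n^'p::{finite,linorder}"
proof -
  have "bcirc (A \<star> B) $ (k, i) $ (l, j) = (bcirc A ** bcirc B) $ (k, i) $ (l, j)" for k l i j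
  proof -
    let ?p = "int CARD('p)" and ?s = "\<lambda>k::'p. int (slice_pos k)"
    let ?kl = "slice_idx (?s k - ?s l) :: 'p"
    let ?f = "\<lambda>h. \<Sum>m\<in>UNIV. A $ slice_idx (?s ?kl - ?s h) $ i $ m * B $ h $ m $ j"
    have "bcirc (A \<star> B) $ (k, i) $ (l, j) = (\<Sum>h\<in>UNIV. ?f h)"
      unfolding bcirc_entry tprod_entry ..
    also have "\<dots> = (\<Sum>h\<in>UNIV. \<Sum>m\<in>UNIV. A $ slice_idx (?s k - ?s h) $ i $ m * B $ slice_idx (?s h - ?s l) $ m $ j)"
    proof (rule sum.reindex_bij_witness[where i = "\<lambda>h. slice_idx (?s h - ?s l)"
          and j = "\<lambda>h. slice_idx (?s h + ?s l)"])
      fix h :: 'p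
      show "slice_idx (?s (slice_idx (?s h + ?s l) :: 'p) - ?s l) = h"
        by (rule slice_idx_eqI) (simp add: slice_pos_slice_idx mod_diff_left_eq slice_pos_less)
      then show "(\<Sum>m\<in>UNIV. A $ slice_idx (?s k - ?s (slice_idx (?s h + ?s l) :: 'p)) $ i $ m *
          B $ slice_idx (?s (slice_idx (?s h + ?s l) :: 'p) - ?s l) $ m $ j) = ?f h"
        by (intro sum.cong refl arg_cong2[where f = "(*)"] arg_cong[where f = "\<lambda>r. A $ r $ i $ _"]
            slice_idx_cong) (simp_all add: slice_pos_slice_idx mod_diff_left_eq mod_diff_right_eq algebra_simps)
      show "slice_idx (?s (slice_idx (?s h - ?s l) :: 'p) + ?s l) = h"
        by (rule slice_idx_eqI) (simp add: slice_pos_slice_idx mod_add_left_eq slice_pos_less)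
    qed auto
    also have "\<dots> = (bcirc A ** bcirc B) $ (k, i) $ (l, j)"
      by (simp add: matrix_matrix_mult_def sum.cartesian_product case_prod_beta bcirc_entry[symmetric])
    finally show ?thesis .
  qed
  then show ?thesis by (simp add: vec_eq_iff split_paired_all)
qed

lemma bcirc_tid: "bcirc tid = mat 1"
proof -
  have "bcirc tid $ (k, i) $ (l, j) = mat 1 $ (k, i) $ (l, j)" for k l :: 'a and i j :: 'b
  proof -
    have "slice_pos (slice_idx (int (slice_pos k) - int (slice_pos l)) :: 'a) = 0 \<longleftrightarrow> k = l"
    proof -
      have "slice_pos (slice_idx (int (slice_pos k) - int (slice_pos l)) :: 'a) = 0 \<longleftrightarrow>
          (int (slice_pos k) - int (slice_pos l)) mod int CARD('a) = 0"
        unfolding slice_pos_slice_idx[symmetric] by simp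
      also have "\<dots> \<longleftrightarrow> int (slice_pos k) mod int CARD('a) = int (slice_pos l) mod int CARD('a)"
        by (simp only: mod_eq_dvd_iff dvd_eq_mod_eq_0)
      also have "\<dots> \<longleftrightarrow> k = l"
        by (simp add: slice_pos_less)
      finally show ?thesis .
    qed
    then show ?thesis by (auto simp: bcirc_entry tid_def mat_def)
  qed
  then show ?thesis by (simp add: vec_eq_iff split_paired_all)
qed

lemma bcirc_tadjoint: "bcirc (tadjoint A) = conj_transpose (bcirc A)"
  for A :: "complex^'n^'m^'p::{finite,linorder}"
proof -
  have "slice_idx (- int (slice_pos (slice_idx (int (slice_pos k) - int (slice_pos l)) :: 'p))) =
      (slice_idx (int (slice_pos l) - int (slice_pos k)) :: 'p)" for k l :: 'p
    by (rule slice_idx_cong) (simp add: slice_pos_slice_idx mod_minus_eq)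
  then have "bcirc (tadjoint A) $ (k, i) $ (l, j) = conj_transpose (bcirc A) $ (k, i) $ (l, j)" for k l i j
    by (simp add: bcirc_entry tadjoint_def conj_transpose_def slice_eq)
  then show ?thesis by (simp add: vec_eq_iff split_paired_all)
qed

text \<open>
  The first block column of the inverse matrix, folded into a tensor, is a right inverse of \<open>A\<close> by the
  very definition of the product.  Its block circulant matrix is then the inverse matrix, which is
  therefore block circulant itself.
\<close>

lemma bcirc_tinv:
  fixes A :: "complex^'n^'n^'p::{finite,linorder}"
  assumes "invertible (bcirc A)"
  shows "bcirc (tinv A) = matrix_inv (bcirc A)"
proof -
  define B :: "complex^'n^'n^'p::{finite,linorder}" where "B = tfold (matrix_inv (bcirc A) ** tunfold tid)"
  have fu: "tfold (tunfold X) = X" and uf: "tunfold (tfold Y) = Y" for X :: "complex^'n^'n^'p::{finite,linorder}" and Y :: "complex^'n^('p \<times> 'n)"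
    by (simp_all add: tfold_def tunfold_def vec_eq_iff)
  have AB: "A \<star> B = tid"
    using matrix_inv_mult[OF assms] by (simp add: tprod_def B_def uf fu matrix_mul_assoc)
  then have m: "bcirc A ** bcirc B = mat 1"
    by (metis bcirc_tprod bcirc_tid)
  then have m': "bcirc B ** bcirc A = mat 1"
    by (simp add: matrix_left_right_inverse)
  then have "B \<star> A = tid"
    by (metis bcirc_inject bcirc_tprod bcirc_tid)
  with AB have "tinv A = B"
    unfolding tinv_def
  proof (intro the_equality conjI)
    fix B' assume "A \<star> B' = tid \<and> B' \<star> A = tid"
    then have "bcirc B' ** bcirc A = mat 1" by (metis bcirc_tprod bcirc_tid)
    then have "bcirc B' ** (bcirc A ** bcirc B) = bcirc B"
      by (simp add: matrix_mul_assoc)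
    then have "bcirc B' = bcirc B" by (simp add: m)
    then show "B' = B" by (simp add: bcirc_inject)
  qed
  moreover have "bcirc B = matrix_inv (bcirc A)"
    using matrix_inv_eqI[OF m] by simp
  ultimately show ?thesis by simp
qed

lemma tinner_tprod_eq_hform:
  fixes A :: "complex^'n^'n^'p::{finite,linorder}" and X :: "complex^1^'n^'p::{finite,linorder}"
  shows "tinner X (A \<star> X) = hform (bcirc A) (\<chi> r. X $ fst r $ snd r $ 1) (\<chi> r. X $ fst r $ snd r $ 1)"
proof -
  let ?x = "\<chi> r. X $ fst r $ snd r $ 1"
  have "tinner X (A \<star> X) = (\<Sum>(k, i)\<in>UNIV. cnj (X $ k $ i $ 1) * (A \<star> X) $ k $ i $ 1)"
    by (simp add: tinner_def sum.cartesian_product)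
  also have "\<dots> = (\<Sum>r\<in>UNIV. \<Sum>s\<in>UNIV. cnj (?x $ r) * bcirc A $ r $ s * ?x $ s)"
    by (intro sum.cong)
      (auto simp: tprod_def tfold_def tunfold_def matrix_matrix_mult_def sum_distrib_left mult.assoc)
  finally show ?thesis by (simp add: hform_def)
qed

lemma T_Hermitian_iff: "A \<in> T_Hermitian \<longleftrightarrow> hermitian (bcirc A)"
  unfolding T_Hermitian_def hermitian_def bcirc_tadjoint[symmetric] bcirc_inject by simp

lemma T_pos_def_iff: "A \<in> T_pos_def \<longleftrightarrow> pos_def (bcirc A)"
  for A :: "complex^'n^'n^'p::{finite,linorder}"
proof (cases "hermitian (bcirc A)")
  case True
  have real: "0 < hform (bcirc A) x x \<longleftrightarrow> 0 < qform (bcirc A) x" for x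
    using hermitian_hform[OF True, of x x]
    by (auto simp: less_complex_def qform_def complex_eq_iff)
  have "(\<forall>X :: complex^1^'n^'p::{finite,linorder}. X \<noteq> 0 \<longrightarrow> 0 < tinner X (A \<star> X)) \<longleftrightarrow>
      (\<forall>x. x \<noteq> 0 \<longrightarrow> 0 < qform (bcirc A) x)"
  proof safe
    fix x :: "complex^('p \<times> 'n)"
    assume pos: "\<forall>X :: complex^1^'n^'p::{finite,linorder}. X \<noteq> 0 \<longrightarrow> 0 < tinner X (A \<star> X)" and "x \<noteq> 0"
    let ?X = "(\<chi> k i j. x $ (k, i)) :: complex^1^'n^'p::{finite,linorder}"
    have "(\<chi> r. ?X $ fst r $ snd r $ 1) = x" by (simp add: vec_eq_iff)
    moreover have "?X \<noteq> 0" using \<open>x \<noteq> 0\<close> by (auto simp: vec_eq_iff)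
    ultimately have "0 < hform (bcirc A) x x"
      using pos[rule_format, of ?X] unfolding tinner_tprod_eq_hform by metis
    then show "0 < qform (bcirc A) x" by (simp only: real)
  next
    fix X :: "complex^1^'n^'p::{finite,linorder}"
    assume pos: "\<forall>x. x \<noteq> 0 \<longrightarrow> 0 < qform (bcirc A) x" and "X \<noteq> 0"
    have "(\<chi> r. X $ fst r $ snd r $ 1) \<noteq> 0"
      using \<open>X \<noteq> 0\<close> by (auto simp: vec_eq_iff forall_1)
    with pos show "0 < tinner X (A \<star> X)"
      by (simp add: tinner_tprod_eq_hform real)
  qed
  with True show ?thesis
    by (simp add: T_pos_def_def T_Hermitian_iff pos_def_def)
next
  case False
  then show ?thesis by (simp add: T_pos_def_def T_Hermitian_iff pos_def_def)
qed

lemma riem_metric_eq: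
  "P \<in> T_pos_def \<Longrightarrow> riem_metric P X X = affine_metric (bcirc P) (bcirc X)"
  by (simp add: T_pos_def_iff riem_metric_def affine_metric_def ttrace_def bcirc_tprod
      bcirc_tinv pos_def_invertible)

text \<open>
  Reversing a path negates its derivative; this makes the speed invariant under reversal.
\<close>

lemma riem_metric_minus: "riem_metric P (- X) (- X) = riem_metric P X X"
  for X :: "complex^'n^'n^'p::{finite,linorder}"
proof -
  have "A \<star> (- B) = - (A \<star> B)" "(- A) \<star> B = - (A \<star> B)" for A B :: "complex^'n^'n^'p::{finite,linorder}"
    by (simp_all add: vec_eq_iff tprod_entry sum_negf)
  then show ?thesis by (simp add: riem_metric_def)
qed

section \<open>The speed of a path\<close>

lemma continuous_on_det:
  fixes M :: "'a::topological_space \<Rightarrow> complex^'N^'N"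
  assumes "continuous_on S M"
  shows "continuous_on S (\<lambda>t. det (M t))"
  unfolding det_def by (intro continuous_intros assms)

lemma continuous_on_matrix_mult:
  fixes M M' :: "'a::topological_space \<Rightarrow> complex^'N^'N"
  assumes "continuous_on S M" "continuous_on S M'"
  shows "continuous_on S (\<lambda>t. M t ** M' t)"
  unfolding matrix_matrix_mult_def by (intro continuous_intros assms)

text \<open>
  Cramer's rule, which makes the continuity of inversion evident.
\<close>

lemma matrix_inv_eq_cramer:
  fixes A :: "'a::field^'N^'N"
  assumes "invertible A"
  shows "matrix_inv A = (\<chi> i k. det (\<chi> r c. if c = i then axis k 1 $ r else A $ r $ c) / det A)"
proof -
  have d: "det A \<noteq> 0" using assms by (simp add: invertible_det_nz)
  have "A *v column k (matrix_inv A) = axis k 1" for k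
  proof -
    have "A *v column k (matrix_inv A) = column k (A ** matrix_inv A)"
      by (simp add: column_def matrix_vector_mult_def matrix_matrix_mult_def)
    then show ?thesis
      by (simp add: matrix_inv_mult[OF assms] column_def mat_def axis_def eq_commute vec_eq_iff)
  qed
  then have "column k (matrix_inv A) = (\<chi> i. det (\<chi> r c. if c = i then axis k 1 $ r else A $ r $ c) / det A)" for k
    using cramer[OF d] by blast
  then show ?thesis by (simp add: vec_eq_iff column_def)
qed

lemma continuous_on_matrix_inv:
  fixes M :: "'a::topological_space \<Rightarrow> complex^'N^'N"
  assumes "continuous_on S M" "\<And>t. t \<in> S \<Longrightarrow> invertible (M t)"
  shows "continuous_on S (\<lambda>t. matrix_inv (M t))"
proof -
  have entry: "continuous_on S (\<lambda>t. if c = i then axis k 1 $ r else M t $ r $ c)" for i k r c :: 'N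
    by (cases "c = i") (auto intro!: continuous_intros assms)
  have "continuous_on S (\<lambda>t. \<chi> i k. det (\<chi> r c. if c = i then axis k 1 $ r else M t $ r $ c) / det (M t))"
    using assms(2) by (intro continuous_intros continuous_on_det entry assms(1)) (auto simp: invertible_det_nz)
  then show ?thesis
    by (rule continuous_on_eq) (simp add: assms(2) matrix_inv_eq_cramer)
qed

lemma continuous_on_affine_metric:
  fixes P H :: "'a::topological_space \<Rightarrow> complex^'N^'N"
  assumes "continuous_on S P" "continuous_on S H" "\<And>t. t \<in> S \<Longrightarrow> invertible (P t)"
  shows "continuous_on S (\<lambda>t. affine_metric (P t) (H t))"
proof -
  have tr: "continuous_on S (\<lambda>t. trace (M t))" if "continuous_on S M" for M :: "'a \<Rightarrow> complex^'N^'N"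
    unfolding trace_def by (intro continuous_intros that)
  show ?thesis unfolding affine_metric_def
    by (intro continuous_intros tr continuous_on_matrix_mult continuous_on_matrix_inv assms)
qed

lemma bounded_linear_qform: "bounded_linear (\<lambda>M. qform M x)"
  by (rule linear_conv_bounded_linear[THEN iffD1]) (simp add: linear_iff qform_add qform_scaleR)

lemma bounded_linear_conj_transpose: "bounded_linear (conj_transpose :: complex^'N^'N \<Rightarrow> _)"
  by (rule linear_conv_bounded_linear[THEN iffD1])
    (simp add: linear_iff conj_transpose_def vec_eq_iff)

definition speed :: "(real \<Rightarrow> complex^'n^'n^'p::{finite,linorder}) \<Rightarrow> real \<Rightarrow> real" where
  "speed \<gamma> t = sqrt (riem_metric (\<gamma> t) (vector_derivative \<gamma> (at t)) (vector_derivative \<gamma> (at t)))"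

lemma riem_length_eq: "riem_length \<gamma> a b = integral {a..b} (speed \<gamma>)"
  by (simp add: riem_length_def speed_def[abs_def])

text \<open>
  Up to the two end points, the speed is a continuous function, hence integrable.  It dominates the
  absolute value of the derivative of \<open>ln (x\<^sup>H P x)\<close> along the path, and the fundamental theorem of
  calculus turns this into the estimate.
\<close>

lemma smooth_piece_speed:
  fixes \<gamma> :: "real \<Rightarrow> complex^'n^'n^'p::{finite,linorder}"
  assumes "u < v" "smooth_on_Icc \<gamma> u v" and T: "\<gamma> ` {u..v} \<subseteq> T_pos_def"
  shows "speed \<gamma> integrable_on {u..v}"
    and "x \<noteq> 0 \<Longrightarrow> \<bar>ln (qform (bcirc (\<gamma> v)) x) - ln (qform (bcirc (\<gamma> u)) x)\<bar> \<le> integral {u..v} (speed \<gamma>)"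
proof -
  obtain D where D0: "\<And>t. t \<in> {u..v} \<Longrightarrow> D 0 t = \<gamma> t"
    and D: "\<And>k t. t \<in> {u..v} \<Longrightarrow> (D k has_vector_derivative D (Suc k) t) (at t within {u..v})"
    using assms(2) unfolding smooth_on_Icc_def by blast
  define g where "g t = bcirc (\<gamma> t)" for t
  define G where "G t = bcirc (D 1 t)" for t
  define \<sigma> where "\<sigma> t = sqrt (affine_metric (g t) (G t))" for t
  have \<gamma>': "(\<gamma> has_vector_derivative D 1 t) (at t within {u..v})" if "t \<in> {u..v}" for t
    unfolding One_nat_def
    by (rule has_vector_derivative_transform[OF that _ D[OF that, of 0]]) (simp add: D0)
  have g': "(g has_vector_derivative G t) (at t within {u..v})" if "t \<in> {u..v}" for t
    unfolding g_def G_def by (rule bounded_linear.has_vector_derivative[OF bounded_linear_bcirc \<gamma>'[OF that]])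
  have pd: "pos_def (g t)" if "t \<in> {u..v}" for t
    using T that by (auto simp: g_def T_pos_def_iff[symmetric])
  have herm: "hermitian (G t)" if t: "t \<in> {u..v}" for t
  proof -
    \<comment> \<open>A path of Hermitian matrices has a Hermitian derivative: conjugate transposition fixes the path and commutes with differentiation.\<close>
    have "((\<lambda>t. conj_transpose (g t)) has_vector_derivative conj_transpose (G t)) (at t within {u..v})"
      by (rule bounded_linear.has_vector_derivative[OF bounded_linear_conj_transpose g'[OF t]])
    then have "(g has_vector_derivative conj_transpose (G t)) (at t within {u..v})"
      by (rule has_vector_derivative_transform[OF t, rotated]) (use pd in \<open>simp add: pos_def_def hermitian_def\<close>)
    with g'[OF t] show ?thesis
      unfolding hermitian_def
      using vector_derivative_unique_within_closed_interval[of u v t g] assms(1) t by auto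
  qed
  have "continuous_on {u..v} (D 1)"
    using D[of _ 1] by (rule continuous_on_vector_derivative)
  then have contG: "continuous_on {u..v} G"
    unfolding G_def by (rule bounded_linear.continuous_on[OF bounded_linear_bcirc])
  have contg: "continuous_on {u..v} g"
    using g' by (rule continuous_on_vector_derivative)
  have cont\<sigma>: "continuous_on {u..v} \<sigma>"
    unfolding \<sigma>_def using pd
    by (intro continuous_intros continuous_on_affine_metric contg contG) (auto intro: pos_def_invertible)
  then have int\<sigma>: "\<sigma> integrable_on {u..v}"
    by (rule integrable_continuous_real)
  have speed: "speed \<gamma> t = \<sigma> t" if "t \<in> {u..v} - {u, v}" for t
  proof -
    have "(\<gamma> has_vector_derivative D 1 t) (at t)"
      using \<gamma>'[of t] that by (simp add: at_within_Icc_at)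
    then have "vector_derivative \<gamma> (at t) = D 1 t"
      by (rule vector_derivative_at)
    moreover have "\<gamma> t \<in> T_pos_def" using T that by auto
    ultimately show ?thesis
      by (simp add: speed_def riem_metric_eq \<sigma>_def g_def G_def)
  qed
  have len: "(speed \<gamma> has_integral integral {u..v} \<sigma>) {u..v}"
    by (rule has_integral_spike_finite[of "{u, v}", OF _ speed]) (use int\<sigma> in auto)
  then show "speed \<gamma> integrable_on {u..v}" by auto
  assume x: "x \<noteq> 0"
  let ?f = "\<lambda>t. ln (qform (g t) x)" and ?f' = "\<lambda>t. qform (G t) x / qform (g t) x"
  have "(?f' has_integral ?f v - ?f u) {u..v}"
  proof (rule fundamental_theorem_of_calculus)
    fix t assume t: "t \<in> {u..v}"
    have "((\<lambda>t. qform (g t) x) has_real_derivative qform (G t) x) (at t within {u..v})"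
      unfolding has_real_derivative_iff_has_vector_derivative
      by (rule bounded_linear.has_vector_derivative[OF bounded_linear_qform g'[OF t]])
    moreover have "0 < qform (g t) x" using pd[OF t] x by (simp add: pos_def_def)
    ultimately have "(?f has_real_derivative ?f' t) (at t within {u..v})"
      by (auto intro!: derivative_eq_intros)
    then show "(?f has_vector_derivative ?f' t) (at t within {u..v})"
      by (simp add: has_real_derivative_iff_has_vector_derivative)
  qed (use assms(1) in simp)
  then have "?f' integrable_on {u..v}" and f: "integral {u..v} ?f' = ?f v - ?f u"
    by (auto simp: integral_unique)
  then have "norm (integral {u..v} ?f') \<le> integral {u..v} \<sigma>"
  proof (intro integral_norm_bound_integral int\<sigma>)
    fix t assume t: "t \<in> {u..v}"
    have "0 < qform (g t) x" using pd[OF t] x by (simp add: pos_def_def)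
    then show "norm (?f' t) \<le> \<sigma> t"
      using qform_le_affine_metric[OF pd[OF t] herm[OF t], of x]
      by (simp add: \<sigma>_def abs_divide pos_divide_le_eq)
  qed
  then show "\<bar>ln (qform (bcirc (\<gamma> v)) x) - ln (qform (bcirc (\<gamma> u)) x)\<bar> \<le> integral {u..v} (speed \<gamma>)"
    using integral_unique[OF len] f by (simp add: g_def)
qed

lemma breakpoints_mono:
  fixes s :: "nat \<Rightarrow> real"
  assumes "\<And>i. i < m \<Longrightarrow> s i < s (Suc i)" "i \<le> j" "j \<le> m"
  shows "s i \<le> s j"
  using assms(2,3)
proof (induction j rule: dec_induct)
  case (step j)
  then show ?case using assms(1)[of j] by simp
qed simp

lemma piecewise_smooth_speed:
  fixes \<gamma> :: "real \<Rightarrow> complex^'n^'n^'p::{finite,linorder}"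
  assumes "\<And>i. i < m \<Longrightarrow> s i < s (Suc i) \<and> smooth_on_Icc \<gamma> (s i) (s (Suc i))"
    and "\<gamma> ` {s 0..s m} \<subseteq> T_pos_def"
  shows "speed \<gamma> integrable_on {s 0..s m} \<and> (\<forall>x. x \<noteq> 0 \<longrightarrow>
    \<bar>ln (qform (bcirc (\<gamma> (s m))) x) - ln (qform (bcirc (\<gamma> (s 0))) x)\<bar> \<le> integral {s 0..s m} (speed \<gamma>))"
  using assms
proof (induction m)
  case 0
  then show ?case using integrable_on_refl[of "speed \<gamma>" "s 0"] by simp
next
  case (Suc m)
  have le: "s 0 \<le> s m" "s m < s (Suc m)"
    using Suc.prems(1) breakpoints_mono[of m s 0 m] by auto
  have "\<gamma> ` {s 0..s m} \<subseteq> T_pos_def"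
    using Suc.prems(2) le by (meson atLeastatMost_subset_iff image_mono less_imp_le order_refl order_trans)
  with Suc.IH Suc.prems(1)
  have IH: "speed \<gamma> integrable_on {s 0..s m}" "\<And>x. x \<noteq> 0 \<Longrightarrow>
    \<bar>ln (qform (bcirc (\<gamma> (s m))) x) - ln (qform (bcirc (\<gamma> (s 0))) x)\<bar> \<le> integral {s 0..s m} (speed \<gamma>)"
    by (metis less_SucI)+
  have sm: "smooth_on_Icc \<gamma> (s m) (s (Suc m))" and T: "\<gamma> ` {s m..s (Suc m)} \<subseteq> T_pos_def"
    using Suc.prems le by (auto simp: image_subset_iff)
  note p = smooth_piece_speed[OF le(2) sm T]
  have int: "speed \<gamma> integrable_on {s 0..s (Suc m)}"
    by (rule Henstock_Kurzweil_Integration.integrable_combine[OF _ _ IH(1) p(1)]) (use le in auto)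
  have "integral {s 0..s m} (speed \<gamma>) + integral {s m..s (Suc m)} (speed \<gamma>) = integral {s 0..s (Suc m)} (speed \<gamma>)"
    by (rule Henstock_Kurzweil_Integration.integral_combine[OF _ _ int]) (use le in auto)
  with IH(2) p(2) have "\<bar>ln (qform (bcirc (\<gamma> (s (Suc m)))) x) - ln (qform (bcirc (\<gamma> (s 0))) x)\<bar>
      \<le> integral {s 0..s (Suc m)} (speed \<gamma>)" if "x \<noteq> 0" for x
    using that by fastforce
  with int show ?case by blast
qed

definition pd_path :: "(real \<Rightarrow> complex^'n^'n^'p::{finite,linorder}) \<Rightarrow> real \<Rightarrow> real \<Rightarrow>
    complex^'n^'n^'p::{finite,linorder} \<Rightarrow> complex^'n^'n^'p::{finite,linorder} \<Rightarrow> bool" where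
  "pd_path \<gamma> a b A B \<longleftrightarrow> a < b \<and> piecewise_smooth_on_Icc \<gamma> a b \<and> \<gamma> ` {a..b} \<subseteq> T_pos_def \<and> \<gamma> a = A \<and> \<gamma> b = B"

lemma pd_path_properties:
  assumes "pd_path \<gamma> a b A B"
  shows pd_path_length: "(speed \<gamma> has_integral riem_length \<gamma> a b) {a..b}"
    and pd_path_ln_qform: "x \<noteq> 0 \<Longrightarrow> \<bar>ln (qform (bcirc B) x) - ln (qform (bcirc A) x)\<bar> \<le> riem_length \<gamma> a b"
proof -
  obtain m s where s: "s 0 = a" "s m = b" "\<And>i. i < m \<Longrightarrow> s i < s (Suc i) \<and> smooth_on_Icc \<gamma> (s i) (s (Suc i))"
    using assms unfolding pd_path_def piecewise_smooth_on_Icc_def by blast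
  have *: "\<gamma> ` {s 0..s m} \<subseteq> T_pos_def" "\<gamma> (s 0) = A" "\<gamma> (s m) = B"
    using assms s by (auto simp: pd_path_def)
  note p = piecewise_smooth_speed[OF s(3) *(1), simplified *, unfolded s(1,2)]
  show "(speed \<gamma> has_integral riem_length \<gamma> a b) {a..b}"
    using p by (auto simp: riem_length_eq)
  show "x \<noteq> 0 \<Longrightarrow> \<bar>ln (qform (bcirc B) x) - ln (qform (bcirc A) x)\<bar> \<le> riem_length \<gamma> a b"
    using p by (auto simp: riem_length_eq)
qed

text \<open>
  At a break point of the path the speed is the square root of an unspecified real number, which may be
  negative; the estimate for logarithms of forms gives the sign of the integral all the same.
\<close>

lemma riem_length_nonneg:
  assumes "pd_path \<gamma> a b A B"
  shows "0 \<le> riem_length \<gamma> a b"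
proof -
  \<comment> \<open>Any nonzero vector serves here.\<close>
  have "axis undefined (1::complex) \<noteq> 0" by (simp add: axis_eq_0_iff)
  from order_trans[OF abs_ge_zero pd_path_ln_qform[OF assms this]] show ?thesis .
qed

section \<open>Reversing, shifting and joining paths\<close>

lemma has_vector_derivative_isometry:
  assumes "(\<gamma> has_vector_derivative D) (at (\<sigma> * t + c) within T)" "(\<lambda>t. \<sigma> * t + c) ` S \<subseteq> T"
  shows "((\<lambda>t. \<gamma> (\<sigma> * t + c)) has_vector_derivative \<sigma> *\<^sub>R D) (at t within S)"
proof -
  have "((\<lambda>t. \<sigma> * t + c) has_vector_derivative \<sigma>) (at t within S)"
    by (auto intro!: derivative_eq_intros)
  moreover have "(\<gamma> has_vector_derivative D) (at (\<sigma> * t + c) within (\<lambda>t. \<sigma> * t + c) ` S)"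
    using assms by (rule has_vector_derivative_within_subset)
  ultimately show ?thesis
    using vector_diff_chain_within[of "\<lambda>t. \<sigma> * t + c" \<sigma> t S \<gamma> D] by (simp add: o_def)
qed

lemma smooth_on_Icc_isometry:
  assumes "smooth_on_Icc \<gamma> u v" "(\<lambda>t. \<sigma> * t + c) ` {u'..v'} \<subseteq> {u..v}"
  shows "smooth_on_Icc (\<lambda>t. \<gamma> (\<sigma> * t + c)) u' v'"
proof -
  obtain D where D0: "\<And>t. t \<in> {u..v} \<Longrightarrow> D 0 t = \<gamma> t"
    and D: "\<And>k t. t \<in> {u..v} \<Longrightarrow> (D k has_vector_derivative D (Suc k) t) (at t within {u..v})"
    using assms(1) unfolding smooth_on_Icc_def by blast
  have *: "((\<lambda>t. \<sigma> ^ k *\<^sub>R D k (\<sigma> * t + c)) has_vector_derivative \<sigma> ^ Suc k *\<^sub>R D (Suc k) (\<sigma> * t + c)) (at t within {u'..v'})"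
    if "t \<in> {u'..v'}" for k t
  proof -
    have "((\<lambda>t. D k (\<sigma> * t + c)) has_vector_derivative \<sigma> *\<^sub>R D (Suc k) (\<sigma> * t + c)) (at t within {u'..v'})"
      by (rule has_vector_derivative_isometry[OF D assms(2)]) (use that assms(2) in blast)
    from bounded_linear.has_vector_derivative[OF bounded_linear_scaleR_right this, of "\<sigma> ^ k"]
    show ?thesis by (simp add: mult.commute)
  qed
  show ?thesis
    unfolding smooth_on_Icc_def
    by (rule exI[of _ "\<lambda>k t. \<sigma> ^ k *\<^sub>R D k (\<sigma> * t + c)"]) (use * D0 assms(2) in auto)
qed

text \<open>
  This includes the times at which \<open>\<gamma>\<close> is not differentiable: since \<open>\<sigma>\<close> is invertible, the
  reparametrized path is then not differentiable either, and both vector derivatives are the same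
  unspecified value.
\<close>

lemma speed_isometry:
  assumes "\<sigma> = 1 \<or> \<sigma> = - 1"
  shows "speed (\<lambda>t. \<gamma> (\<sigma> * t + c)) t = speed \<gamma> (\<sigma> * t + c)"
proof -
  let ?\<gamma>' = "\<lambda>t. \<gamma> (\<sigma> * t + c)" and ?s = "\<sigma> * t + c"
  have sq: "\<sigma> * \<sigma> = 1" using assms by auto
  have fwd: "(?\<gamma>' has_vector_derivative \<sigma> *\<^sub>R D) (at t)" if "(\<gamma> has_vector_derivative D) (at ?s)" for D
    using has_vector_derivative_isometry[OF that, of UNIV] by simp
  \<comment> \<open>The isometry \<open>s \<mapsto> \<sigma> s - \<sigma> c\<close> is the inverse reparametrization.\<close>
  have bwd: "(\<gamma> has_vector_derivative \<sigma> *\<^sub>R D) (at ?s)" if "(?\<gamma>' has_vector_derivative D) (at t)" for D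
  proof -
    have "\<sigma> * ?s - \<sigma> * c = t" by (simp add: algebra_simps sq flip: mult.assoc)
    moreover have "(\<lambda>s. ?\<gamma>' (\<sigma> * s + - \<sigma> * c)) = \<gamma>"
      by (simp add: algebra_simps sq flip: mult.assoc)
    ultimately show ?thesis
      using has_vector_derivative_isometry[of ?\<gamma>' D \<sigma> ?s "- \<sigma> * c" UNIV UNIV] that by simp
  qed
  show ?thesis
  proof (cases "\<gamma> differentiable (at ?s)")
    case True
    then have "vector_derivative ?\<gamma>' (at t) = \<sigma> *\<^sub>R vector_derivative \<gamma> (at ?s)"
      by (intro vector_derivative_at fwd) (simp add: vector_derivative_works)
    with assms show ?thesis by (auto simp: speed_def riem_metric_minus)
  next
    case False
    then have "\<not> (\<gamma> has_vector_derivative D) (at ?s)" for D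
      using differentiableI_vector by blast
    with bwd have "(\<lambda>D. (?\<gamma>' has_vector_derivative D) (at t)) = (\<lambda>D. (\<gamma> has_vector_derivative D) (at ?s))"
      by blast
    then have "vector_derivative ?\<gamma>' (at t) = vector_derivative \<gamma> (at ?s)"
      by (simp add: vector_derivative_def)
    then show ?thesis by (simp add: speed_def)
  qed
qed

lemma pd_path_shift:
  assumes "pd_path \<gamma> a b A B"
  shows "pd_path (\<lambda>t. \<gamma> (t + c)) (a - c) (b - c) A B"
    and "riem_length (\<lambda>t. \<gamma> (t + c)) (a - c) (b - c) = riem_length \<gamma> a b"
proof -
  obtain m s where s: "s 0 = a" "s m = b" "\<And>i. i < m \<Longrightarrow> s i < s (Suc i) \<and> smooth_on_Icc \<gamma> (s i) (s (Suc i))"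
    using assms unfolding pd_path_def piecewise_smooth_on_Icc_def by blast
  have "smooth_on_Icc (\<lambda>t. \<gamma> (t + c)) (s i - c) (s (Suc i) - c)" if "i < m" for i
    using smooth_on_Icc_isometry[of \<gamma> "s i" "s (Suc i)" 1 c "s i - c" "s (Suc i) - c"] s(3)[OF that] by auto
  with s have "piecewise_smooth_on_Icc (\<lambda>t. \<gamma> (t + c)) (a - c) (b - c)"
    unfolding piecewise_smooth_on_Icc_def by (intro exI[of _ m] exI[of _ "\<lambda>i. s i - c"]) auto
  then show "pd_path (\<lambda>t. \<gamma> (t + c)) (a - c) (b - c) A B"
    using assms by (auto simp: pd_path_def image_subset_iff)
  have "((\<lambda>t. speed \<gamma> (t + c)) has_integral riem_length \<gamma> a b) {a - c..b - c}"
    using has_integral_affinity[of "speed \<gamma>" "riem_length \<gamma> a b" a b 1 c] pd_path_length[OF assms] by simp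
  moreover have "speed (\<lambda>t. \<gamma> (t + c)) = (\<lambda>t. speed \<gamma> (t + c))"
    using speed_isometry[of 1 \<gamma> c] by (intro ext) simp
  ultimately show "riem_length (\<lambda>t. \<gamma> (t + c)) (a - c) (b - c) = riem_length \<gamma> a b"
    by (simp only: riem_length_eq integral_unique)
qed

lemma pd_path_reverse:
  assumes "pd_path \<gamma> a b A B"
  shows "pd_path (\<lambda>t. \<gamma> (- t)) (- b) (- a) B A"
    and "riem_length (\<lambda>t. \<gamma> (- t)) (- b) (- a) = riem_length \<gamma> a b"
proof -
  obtain m s where s: "s 0 = a" "s m = b" "\<And>i. i < m \<Longrightarrow> s i < s (Suc i) \<and> smooth_on_Icc \<gamma> (s i) (s (Suc i))"
    using assms unfolding pd_path_def piecewise_smooth_on_Icc_def by blast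
  have "- s (m - i) < - s (m - Suc i) \<and> smooth_on_Icc (\<lambda>t. \<gamma> (- t)) (- s (m - i)) (- s (m - Suc i))" if "i < m" for i
  proof -
    have "m - i = Suc (m - Suc i)" "m - Suc i < m" using that by auto
    then have "s (m - Suc i) < s (m - i)" "smooth_on_Icc \<gamma> (s (m - Suc i)) (s (m - i))"
      using s(3)[of "m - Suc i"] by auto
    then show ?thesis
      using smooth_on_Icc_isometry[of \<gamma> "s (m - Suc i)" "s (m - i)" "-1" 0 "- s (m - i)" "- s (m - Suc i)"] by auto
  qed
  with s have "piecewise_smooth_on_Icc (\<lambda>t. \<gamma> (- t)) (- b) (- a)"
    unfolding piecewise_smooth_on_Icc_def by (intro exI[of _ m] exI[of _ "\<lambda>i. - s (m - i)"]) auto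
  then show "pd_path (\<lambda>t. \<gamma> (- t)) (- b) (- a) B A"
    using assms by (auto simp: pd_path_def image_subset_iff)
  have "((\<lambda>t. speed \<gamma> (- t)) has_integral riem_length \<gamma> a b) {- b..- a}"
    using has_integral_affinity[of "speed \<gamma>" "riem_length \<gamma> a b" a b "-1" 0] pd_path_length[OF assms] by simp
  moreover have "speed (\<lambda>t. \<gamma> (- t)) = (\<lambda>t. speed \<gamma> (- t))"
    using speed_isometry[of "-1" \<gamma> 0] by (intro ext) simp
  ultimately show "riem_length (\<lambda>t. \<gamma> (- t)) (- b) (- a) = riem_length \<gamma> a b"
    by (simp only: riem_length_eq integral_unique)
qed

lemma smooth_on_Icc_cong:
  "smooth_on_Icc \<gamma> u v \<Longrightarrow> (\<And>t. t \<in> {u..v} \<Longrightarrow> \<gamma>' t = \<gamma> t) \<Longrightarrow> smooth_on_Icc \<gamma>' u v"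
  by (simp add: smooth_on_Icc_def)

lemma speed_cong:
  assumes "\<forall>\<^sub>F s in nhds t. \<gamma>' s = \<gamma> s"
  shows "speed \<gamma>' t = speed \<gamma> t"
proof -
  have "vector_derivative \<gamma>' (at t) = vector_derivative \<gamma> (at t)"
    using assms by (intro vector_derivative_cong_eq) auto
  moreover have "\<gamma>' t = \<gamma> t" using assms by (rule eventually_nhds_x_imp_x)
  ultimately show ?thesis by (simp add: speed_def)
qed

lemma pd_path_join:
  assumes "pd_path \<gamma>1 a b A B" "pd_path \<gamma>2 b d B C"
  defines "\<gamma> \<equiv> \<lambda>t. if t \<le> b then \<gamma>1 t else \<gamma>2 t"
  shows "pd_path \<gamma> a d A C" and "riem_length \<gamma> a d = riem_length \<gamma>1 a b + riem_length \<gamma>2 b d"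
proof -
  obtain m s where s: "s 0 = a" "s m = b" "\<And>i. i < m \<Longrightarrow> s i < s (Suc i) \<and> smooth_on_Icc \<gamma>1 (s i) (s (Suc i))"
    using assms unfolding pd_path_def piecewise_smooth_on_Icc_def by blast
  obtain n r where r: "r 0 = b" "r n = d" "\<And>i. i < n \<Longrightarrow> r i < r (Suc i) \<and> smooth_on_Icc \<gamma>2 (r i) (r (Suc i))"
    using assms unfolding pd_path_def piecewise_smooth_on_Icc_def by blast
  have ends: "a < b" "b < d" "\<gamma>1 a = A" "\<gamma>1 b = B" "\<gamma>2 b = B" "\<gamma>2 d = C"
    using assms by (auto simp: pd_path_def)
  define q where "q i = (if i \<le> m then s i else r (i - m))" for i
  have "q i < q (Suc i) \<and> smooth_on_Icc \<gamma> (q i) (q (Suc i))" if i: "i < m + n" for i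
  proof (cases "i < m")
    case True
    then have q: "q i = s i" "q (Suc i) = s (Suc i)" by (auto simp: q_def)
    have "s (Suc i) \<le> b"
      using breakpoints_mono[of m s "Suc i" m] s True by auto
    then show ?thesis
      unfolding q using s(3)[OF True] by (auto simp: \<gamma>_def intro: smooth_on_Icc_cong)
  next
    case False
    then have q: "q i = r (i - m)" "q (Suc i) = r (Suc (i - m))"
      using s(2) r(1) by (auto simp: q_def Suc_diff_le)
    have lt: "i - m < n" using i False by simp
    have ge: "b \<le> r (i - m)"
      using breakpoints_mono[of n r 0 "i - m"] r lt by auto
    have eq: "\<gamma> t = \<gamma>2 t" if "b \<le> t" for t
      using that ends(4,5) by (cases "t = b") (auto simp: \<gamma>_def)
    have "smooth_on_Icc \<gamma> (r (i - m)) (r (Suc (i - m)))"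
    proof (rule smooth_on_Icc_cong)
      show "smooth_on_Icc \<gamma>2 (r (i - m)) (r (Suc (i - m)))"
        using r(3)[OF lt] by blast
      fix t assume "t \<in> {r (i - m)..r (Suc (i - m))}"
      with ge have "b \<le> t" by (meson atLeastAtMost_iff order_trans)
      then show "\<gamma> t = \<gamma>2 t" by (rule eq)
    qed
    then show ?thesis
      unfolding q using r(3)[OF lt] by auto
  qed
  moreover have "q 0 = a" "q (m + n) = d"
    using s r by (auto simp: q_def)
  ultimately have "piecewise_smooth_on_Icc \<gamma> a d"
    unfolding piecewise_smooth_on_Icc_def by (intro exI[of _ "m + n"] exI[of _ q]) auto
  moreover have "\<gamma> ` {a..d} \<subseteq> T_pos_def"
    using assms(1,2) by (auto simp: pd_path_def \<gamma>_def image_subset_iff)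
  ultimately show "pd_path \<gamma> a d A C"
    using ends by (simp add: pd_path_def \<gamma>_def)
  have "(speed \<gamma> has_integral riem_length \<gamma>1 a b) {a..b}"
  proof (rule has_integral_spike_finite[OF _ _ pd_path_length[OF assms(1)], of "{b}"])
    fix t assume "t \<in> {a..b} - {b}"
    then have "\<forall>\<^sub>F s in nhds t. s < b"
      by (intro eventually_nhds_in_open[of "{..<b}", simplified]) auto
    then show "speed \<gamma> t = speed \<gamma>1 t"
      by (intro speed_cong) (auto elim!: eventually_mono simp: \<gamma>_def)
  qed simp
  moreover have "(speed \<gamma> has_integral riem_length \<gamma>2 b d) {b..d}"
  proof (rule has_integral_spike_finite[OF _ _ pd_path_length[OF assms(2)], of "{b}"])
    fix t assume "t \<in> {b..d} - {b}"
    then have "\<forall>\<^sub>F s in nhds t. b < s"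
      by (intro eventually_nhds_in_open[of "{b<..}", simplified]) auto
    then show "speed \<gamma> t = speed \<gamma>2 t"
      by (intro speed_cong) (auto elim!: eventually_mono simp: \<gamma>_def)
  qed simp
  ultimately have "(speed \<gamma> has_integral riem_length \<gamma>1 a b + riem_length \<gamma>2 b d) {a..d}"
    using ends by (intro has_integral_combine[of a b d]) auto
  then show "riem_length \<gamma> a d = riem_length \<gamma>1 a b + riem_length \<gamma>2 b d"
    by (simp add: riem_length_eq integral_unique)
qed

section \<open>The Riemannian distance\<close>

lemma T_pos_def_qform_pos: "A \<in> T_pos_def \<Longrightarrow> x \<noteq> 0 \<Longrightarrow> 0 < qform (bcirc A) x"
  by (simp add: T_pos_def_iff pos_def_def)

lemma pd_path_segment:
  fixes A B :: "complex^'n^'n^'p::{finite,linorder}"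
  assumes "A \<in> T_pos_def" "B \<in> T_pos_def"
  shows "pd_path (\<lambda>t. A + t *\<^sub>R (B - A)) 0 1 A B"
proof -
  let ?\<gamma> = "\<lambda>t. A + t *\<^sub>R (B - A)"
  \<comment> \<open>The successive derivatives of the affine path.\<close>
  define D where "D k = (case k of 0 \<Rightarrow> ?\<gamma> | Suc 0 \<Rightarrow> (\<lambda>t. B - A) | _ \<Rightarrow> (\<lambda>t. 0))" for k
  have "(D k has_vector_derivative D (Suc k) t) (at t within {0..1})" for k t
    by (auto simp: D_def split: nat.splits intro!: derivative_eq_intros)
  then have "smooth_on_Icc ?\<gamma> 0 1"
    unfolding smooth_on_Icc_def by (intro exI[of _ D]) (auto simp: D_def)
  then have "piecewise_smooth_on_Icc ?\<gamma> 0 1"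
    unfolding piecewise_smooth_on_Icc_def by (intro exI[of _ 1] exI[of _ real]) auto
  moreover have "?\<gamma> t \<in> T_pos_def" if t: "t \<in> {0..1}" for t
  proof -
    have eq: "bcirc (?\<gamma> t) = (1 - t) *\<^sub>R bcirc A + t *\<^sub>R bcirc B"
      by (simp add: bcirc_add bcirc_diff bcirc_scaleR algebra_simps)
    have "hermitian (bcirc (?\<gamma> t))"
      using assms unfolding eq T_pos_def_iff pos_def_def hermitian_def
      by (simp add: conj_transpose_def vec_eq_iff)
    moreover have "0 < qform (bcirc (?\<gamma> t)) x" if "x \<noteq> 0" for x
    proof (cases "t = 0")
      case True
      then show ?thesis using T_pos_def_qform_pos[OF assms(1) that] by simp
    next
      case False
      have "0 \<le> (1 - t) * qform (bcirc A) x" "0 < t * qform (bcirc B) x"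
        using t False T_pos_def_qform_pos[OF assms(1) that] T_pos_def_qform_pos[OF assms(2) that] by auto
      then show ?thesis unfolding eq qform_add qform_scaleR by linarith
    qed
    ultimately show ?thesis by (simp add: T_pos_def_iff pos_def_def)
  qed
  ultimately show ?thesis by (auto simp: pd_path_def)
qed

text \<open>
  The form at the point with parameter \<open>t\<close> is the convex combination of the forms at the end points, so
  the two hypotheses bound the form of the constant derivative \<open>B - A\<close> relative to every point of the
  segment, and with it the speed.
\<close>

lemma riem_length_segment_le:
  fixes A B :: "complex^'n^'n^'p::{finite,linorder}" and \<eta> :: real
  assumes "A \<in> T_pos_def" "B \<in> T_pos_def"
    and "\<And>x. \<bar>qform (bcirc B) x - qform (bcirc A) x\<bar> \<le> \<eta> * qform (bcirc A) x"
    and "\<And>x. \<bar>qform (bcirc B) x - qform (bcirc A) x\<bar> \<le> \<eta> * qform (bcirc B) x"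
  shows "riem_length (\<lambda>t. A + t *\<^sub>R (B - A)) 0 1 \<le> CARD('p \<times> 'n) * \<eta>"
proof -
  let ?\<gamma> = "\<lambda>t. A + t *\<^sub>R (B - A)"
  note path = pd_path_segment[OF assms(1,2)]
  have "speed ?\<gamma> t \<le> CARD('p \<times> 'n) * \<eta>" if t: "t \<in> {0..1}" for t
  proof -
    have T: "?\<gamma> t \<in> T_pos_def" using path t by (auto simp: pd_path_def image_subset_iff)
    have "(?\<gamma> has_vector_derivative B - A) (at t)"
      by (auto intro!: derivative_eq_intros)
    then have sp: "speed ?\<gamma> t = sqrt (affine_metric (bcirc (?\<gamma> t)) (bcirc (B - A)))"
      by (simp add: speed_def riem_metric_eq[OF T] vector_derivative_at)
    have "hermitian (bcirc (B - A))"
      using assms(1,2) by (simp add: bcirc_diff T_pos_def_iff pos_def_def hermitian_diff)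
    moreover have "\<bar>qform (bcirc (B - A)) x\<bar> \<le> \<eta> * qform (bcirc (?\<gamma> t)) x" for x
    proof -
      let ?d = "\<bar>qform (bcirc B) x - qform (bcirc A) x\<bar>"
      have "(1 - t) * ?d \<le> (1 - t) * (\<eta> * qform (bcirc A) x)" "t * ?d \<le> t * (\<eta> * qform (bcirc B) x)"
        using t by (auto intro!: mult_left_mono assms(3,4))
      then have "?d \<le> (1 - t) * (\<eta> * qform (bcirc A) x) + t * (\<eta> * qform (bcirc B) x)"
        by (simp add: left_diff_distrib)
      then show ?thesis
        by (simp add: bcirc_add bcirc_diff bcirc_scaleR qform_add qform_diff qform_scaleR algebra_simps)
    qed
    ultimately show ?thesis
      unfolding sp using T by (intro affine_metric_le) (simp_all add: T_pos_def_iff)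
  qed
  moreover have "((\<lambda>_. CARD('p \<times> 'n) * \<eta>) has_integral CARD('p \<times> 'n) * \<eta>) {0..1::real}"
    using has_integral_const_real[of "CARD('p \<times> 'n) * \<eta>" 0 1] by simp
  ultimately show ?thesis
    using has_integral_le[OF pd_path_length[OF path]] by blast
qed

lemma riem_dist_eq_Inf:
  assumes "A \<in> T_pos_def" "B \<in> T_pos_def"
  shows "riem_dist A B = Inf {riem_length \<gamma> a b |\<gamma> a b. pd_path \<gamma> a b A B}"
  using assms by (simp add: riem_dist_def pd_path_def)

lemma riem_dist_le_length:
  assumes "pd_path \<gamma> a b A B"
  shows "riem_dist A B \<le> riem_length \<gamma> a b"
proof -
  have T: "A \<in> T_pos_def" "B \<in> T_pos_def"
    using assms by (auto simp: pd_path_def image_subset_iff)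
  have "bdd_below {riem_length \<gamma> a b |\<gamma> a b. pd_path \<gamma> a b A B}"
    using riem_length_nonneg by (intro bdd_belowI[of _ 0]) blast
  then show ?thesis
    unfolding riem_dist_eq_Inf[OF T] using assms by (intro cInf_lower) auto
qed

lemma riem_dist_greatest:
  assumes "A \<in> T_pos_def" "B \<in> T_pos_def" "\<And>\<gamma> a b. pd_path \<gamma> a b A B \<Longrightarrow> c \<le> riem_length \<gamma> a b"
  shows "c \<le> riem_dist A B"
  unfolding riem_dist_eq_Inf[OF assms(1,2)]
  using pd_path_segment[OF assms(1,2)] assms(3) by (intro cInf_greatest) auto

lemma riem_dist_nonneg: "0 \<le> riem_dist A B"
proof (cases "A \<in> T_pos_def \<and> B \<in> T_pos_def")
  case True
  then show ?thesis using riem_length_nonneg by (intro riem_dist_greatest) auto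
next
  case False
  then show ?thesis by (simp only: riem_dist_def if_False order_refl)
qed

text \<open>
  The distance controls the quadratic forms uniformly in \<open>x\<close>; in the Loewner order, \<open>A\<close> and \<open>B\<close> lie
  between multiples of each other with factors \<open>exp (\<plusminus> riem_dist A B)\<close>.
\<close>

lemma ln_qform_le_riem_dist:
  assumes "A \<in> T_pos_def" "B \<in> T_pos_def" "x \<noteq> 0"
  shows "\<bar>ln (qform (bcirc B) x) - ln (qform (bcirc A) x)\<bar> \<le> riem_dist A B"
  using assms by (intro riem_dist_greatest pd_path_ln_qform) auto

text \<open>
  The segment competes in the infimum, so its length is an upper bound for the distance.
\<close>

lemma riem_dist_le_of_qform:
  fixes A B :: "complex^'n^'n^'p::{finite,linorder}" and \<eta> :: real
  assumes "A \<in> T_pos_def" "B \<in> T_pos_def"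
    and "\<And>x. \<bar>qform (bcirc B) x - qform (bcirc A) x\<bar> \<le> \<eta> * qform (bcirc A) x"
    and "\<And>x. \<bar>qform (bcirc B) x - qform (bcirc A) x\<bar> \<le> \<eta> * qform (bcirc B) x"
  shows "riem_dist A B \<le> CARD('p \<times> 'n) * \<eta>"
  using riem_dist_le_length[OF pd_path_segment[OF assms(1,2)]] riem_length_segment_le[OF assms]
  by (rule order_trans)

lemma hermitian_eqI:
  assumes "hermitian M" "hermitian M'" "\<And>x. qform M x = qform M' x"
  shows "M = M'"
proof -
  have "norm ((M - M') $ i $ j) \<le> 0" for i j
    by (rule hermitian_entry_bound) (use assms in \<open>auto simp: hermitian_diff qform_diff\<close>)
  then show ?thesis by (simp add: vec_eq_iff)
qed

text \<open>
  At distance zero the lower bound makes the quadratic forms agree, and these determine the tensor; the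
  converse is the upper bound with \<open>\<eta> = 0\<close>.
\<close>

lemma riem_dist_eq_0_iff:
  fixes A B :: "complex^'n^'n^'p::{finite,linorder}"
  assumes "A \<in> T_pos_def" "B \<in> T_pos_def"
  shows "riem_dist A B = 0 \<longleftrightarrow> A = B"
proof
  assume 0: "riem_dist A B = 0"
  have "qform (bcirc A) x = qform (bcirc B) x" for x
  proof (cases "x = 0")
    case False
    then have "ln (qform (bcirc B) x) = ln (qform (bcirc A) x)"
      using ln_qform_le_riem_dist[OF assms False] 0 by simp
    then show ?thesis
      using T_pos_def_qform_pos[OF assms(1) False] T_pos_def_qform_pos[OF assms(2) False] by simp
  qed simp
  then have "bcirc A = bcirc B"
    using assms by (intro hermitian_eqI) (auto simp: T_pos_def_iff pos_def_def)
  then show "A = B" by (simp add: bcirc_inject)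
next
  assume "A = B"
  then have "riem_dist A B \<le> 0"
    using riem_dist_le_of_qform[OF assms, of 0] by simp
  with riem_dist_nonneg show "riem_dist A B = 0" by (rule antisym[rotated])
qed

lemma riem_dist_commute_le:
  assumes "A \<in> T_pos_def" "B \<in> T_pos_def"
  shows "riem_dist B A \<le> riem_dist A B"
proof (rule riem_dist_greatest[OF assms])
  fix \<gamma> a b assume "pd_path \<gamma> a b A B"
  from riem_dist_le_length[OF pd_path_reverse(1)[OF this]] pd_path_reverse(2)[OF this]
  show "riem_dist B A \<le> riem_length \<gamma> a b" by simp
qed

lemma riem_dist_commute: "riem_dist A B = riem_dist B A"
proof (cases "A \<in> T_pos_def \<and> B \<in> T_pos_def")
  case True
  then show ?thesis by (intro antisym riem_dist_commute_le) auto
next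
  case False
  then have "\<not> (B \<in> T_pos_def \<and> A \<in> T_pos_def)" by blast
  with False show ?thesis by (simp only: riem_dist_def if_False)
qed

lemma riem_dist_triangle:
  assumes "A \<in> T_pos_def" "B \<in> T_pos_def" "C \<in> T_pos_def"
  shows "riem_dist A C \<le> riem_dist A B + riem_dist B C"
proof -
  have "riem_dist A C \<le> riem_length \<gamma>1 a b + riem_length \<gamma>2 c d"
    if \<gamma>1: "pd_path \<gamma>1 a b A B" and \<gamma>2: "pd_path \<gamma>2 c d B C" for \<gamma>1 a b \<gamma>2 c d
  proof -
    note shift = pd_path_shift[OF \<gamma>2, of "c - b"]
    then have "pd_path (\<lambda>t. \<gamma>2 (t + (c - b))) b (d - (c - b)) B C" by simp
    note join = pd_path_join[OF \<gamma>1 this]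
    from riem_dist_le_length[OF join(1)] join(2) shift(2) show ?thesis by simp
  qed
  then have *: "riem_dist A C - riem_length \<gamma>1 a b \<le> riem_length \<gamma>2 c d"
    if "pd_path \<gamma>1 a b A B" "pd_path \<gamma>2 c d B C" for \<gamma>1 a b \<gamma>2 c d
    using that by (simp add: diff_le_eq add.commute)
  have "riem_dist A C - riem_length \<gamma>1 a b \<le> riem_dist B C" if "pd_path \<gamma>1 a b A B" for \<gamma>1 a b
    by (rule riem_dist_greatest[OF assms(2,3) *[OF that]])
  then have "riem_dist A C - riem_dist B C \<le> riem_length \<gamma>1 a b" if "pd_path \<gamma>1 a b A B" for \<gamma>1 a b
    using that by (simp add: diff_le_eq add.commute)
  then have "riem_dist A C - riem_dist B C \<le> riem_dist A B"
    by (rule riem_dist_greatest[OF assms(1,2)])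
  then show ?thesis by simp
qed

lemma Metric_space_riem_dist: "Metric_space T_pos_def riem_dist"
  by unfold_locales (fact riem_dist_nonneg riem_dist_commute riem_dist_eq_0_iff riem_dist_triangle)+

section \<open>Completeness\<close>

lemma abs_diff_le_of_ln:
  fixes a b :: real
  assumes "0 < a" "0 < b" "\<bar>ln a - ln b\<bar> \<le> \<epsilon>"
  shows "\<bar>a - b\<bar> \<le> (exp \<epsilon> - 1) * a"
proof -
  have "0 \<le> \<epsilon>" using assms(3) by simp
  have "ln b \<le> ln a + \<epsilon>" "ln a \<le> ln b + \<epsilon>" using assms(3) by auto
  then have "exp (ln b) \<le> exp (ln a + \<epsilon>)" "exp (ln a) \<le> exp (ln b + \<epsilon>)" by (simp_all only: exp_le_cancel_iff)
  then have b: "b \<le> exp \<epsilon> * a" and a: "a \<le> exp \<epsilon> * b"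
    using assms by (simp_all add: exp_add mult.commute)
  show ?thesis
  proof (cases "a \<le> b")
    case True
    then show ?thesis using b by (simp add: left_diff_distrib)
  next
    case False
    have "a - b \<le> (exp \<epsilon> - 1) * b" using a by (simp add: left_diff_distrib)
    also have "\<dots> \<le> (exp \<epsilon> - 1) * a" using False \<open>0 \<le> \<epsilon>\<close> by (intro mult_left_mono) auto
    finally show ?thesis using False by simp
  qed
qed

text \<open>
  The distance bounds the ratio of two forms uniformly in \<open>x\<close>, so at small distance the ratio is
  close to 1.
\<close>

lemma riem_MCauchy_qform:
  fixes \<sigma> :: "nat \<Rightarrow> complex^'n^'n^'p::{finite,linorder}"
  assumes "Metric_space.MCauchy T_pos_def riem_dist \<sigma>" "0 < \<eta>"
  shows "\<exists>N. \<forall>m\<ge>N. \<forall>n\<ge>N. \<forall>x.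
    \<bar>qform (bcirc (\<sigma> m)) x - qform (bcirc (\<sigma> n)) x\<bar> \<le> \<eta> * qform (bcirc (\<sigma> m)) x"
proof -
  \<comment> \<open>Logarithms differing by at most this \<open>\<epsilon>\<close> belong to numbers differing by a factor of at most \<open>1 + \<eta>\<close>.\<close>
  define \<epsilon> where "\<epsilon> = ln (1 + \<eta>)"
  have "0 < \<epsilon>" and \<eta>: "exp \<epsilon> - 1 = \<eta>" using assms(2) by (simp_all add: \<epsilon>_def)
  note C = assms(1)[unfolded Metric_space.MCauchy_def[OF Metric_space_riem_dist]]
  then have T: "\<sigma> n \<in> T_pos_def" for n by auto
  from C \<open>0 < \<epsilon>\<close> obtain N where N: "\<And>n n'. N \<le> n \<Longrightarrow> N \<le> n' \<Longrightarrow> riem_dist (\<sigma> n) (\<sigma> n') < \<epsilon>"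
    by blast
  have "\<bar>qform (bcirc (\<sigma> m)) x - qform (bcirc (\<sigma> n)) x\<bar> \<le> \<eta> * qform (bcirc (\<sigma> m)) x"
    if "N \<le> m" "N \<le> n" for m n x
  proof (cases "x = 0")
    case False
    have "\<bar>ln (qform (bcirc (\<sigma> m)) x) - ln (qform (bcirc (\<sigma> n)) x)\<bar> \<le> \<epsilon>"
      using order_trans[OF ln_qform_le_riem_dist[OF T T False] less_imp_le[OF N[OF that(2,1)]]] .
    then show ?thesis
      unfolding \<eta>[symmetric] by (intro abs_diff_le_of_ln T_pos_def_qform_pos T False)
  qed simp
  then show ?thesis by blast
qed

text \<open>
  All late members of the sequence have forms bounded by a multiple of the squared norm, so the relative
  closeness of forms becomes an absolute one, and polarization makes the entries Cauchy.
\<close>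

lemma riem_MCauchy_convergent:
  fixes \<sigma> :: "nat \<Rightarrow> complex^'n^'n^'p::{finite,linorder}"
  assumes "Metric_space.MCauchy T_pos_def riem_dist \<sigma>"
  obtains A where "\<sigma> \<longlonglongrightarrow> A"
proof -
  have T: "\<sigma> n \<in> T_pos_def" for n
    using assms[unfolded Metric_space.MCauchy_def[OF Metric_space_riem_dist]] by auto
  obtain N where N: "\<And>m n x. N \<le> m \<Longrightarrow> N \<le> n \<Longrightarrow>
      \<bar>qform (bcirc (\<sigma> m)) x - qform (bcirc (\<sigma> n)) x\<bar> \<le> 1 * qform (bcirc (\<sigma> m)) x"
    using riem_MCauchy_qform[OF assms zero_less_one] by blast
  \<comment> \<open>The factor 2 comes from the late forms being at most twice the form at \<open>N\<close>.\<close>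
  define K where "K = 2 * sqrt (\<Sum>i\<in>UNIV. \<Sum>j\<in>UNIV. (norm (bcirc (\<sigma> N) $ i $ j))\<^sup>2)"
  have K0: "0 \<le> K" by (simp add: K_def sum_nonneg)
  have K: "qform (bcirc (\<sigma> n)) x \<le> K * (norm x)\<^sup>2" if "N \<le> n" for n x
    using N[OF order_refl that, of x] qform_le_Frobenius[of "bcirc (\<sigma> N)" x]
    by (simp add: K_def)
  have entry: "Cauchy (\<lambda>n. bcirc (\<sigma> n) $ r $ c)" for r c
  proof (rule metric_CauchyI)
    fix e :: real assume "0 < e"
    define \<eta> where "\<eta> = e / (K + 1)"
    have "0 < \<eta>" "\<eta> * K < e" using \<open>0 < e\<close> K0 by (auto simp: \<eta>_def field_simps)
    from riem_MCauchy_qform[OF assms \<open>0 < \<eta>\<close>] obtain N' where N': "\<And>m n x. N' \<le> m \<Longrightarrow> N' \<le> n \<Longrightarrow>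
        \<bar>qform (bcirc (\<sigma> m)) x - qform (bcirc (\<sigma> n)) x\<bar> \<le> \<eta> * qform (bcirc (\<sigma> m)) x"
      by blast
    have "dist (bcirc (\<sigma> m) $ r $ c) (bcirc (\<sigma> n) $ r $ c) < e"
      if m: "max N N' \<le> m" and n: "max N N' \<le> n" for m n
    proof -
      have "hermitian (bcirc (\<sigma> m) - bcirc (\<sigma> n))"
        using T by (simp add: T_pos_def_iff pos_def_def hermitian_diff)
      moreover have "\<bar>qform (bcirc (\<sigma> m) - bcirc (\<sigma> n)) x\<bar> \<le> (\<eta> * K) * (norm x)\<^sup>2" for x
      proof -
        have "\<bar>qform (bcirc (\<sigma> m) - bcirc (\<sigma> n)) x\<bar> \<le> \<eta> * qform (bcirc (\<sigma> m)) x"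
          using N'[of m n x] m n by (simp add: qform_diff)
        also have "\<dots> \<le> \<eta> * (K * (norm x)\<^sup>2)"
          using \<open>0 < \<eta>\<close> m by (intro mult_left_mono K) auto
        finally show ?thesis by (simp add: mult.assoc)
      qed
      ultimately have "norm ((bcirc (\<sigma> m) - bcirc (\<sigma> n)) $ r $ c) \<le> \<eta> * K"
        by (rule hermitian_entry_bound)
      with \<open>\<eta> * K < e\<close> show ?thesis by (simp add: dist_norm)
    qed
    then show "\<exists>M. \<forall>m\<ge>M. \<forall>n\<ge>M. dist (bcirc (\<sigma> m) $ r $ c) (bcirc (\<sigma> n) $ r $ c) < e"
      by blast
  qed
  obtain z :: 'p where z: "slice_pos z = 0" using ex_slice_pos_0 by auto
  have conv: "convergent (\<lambda>n. \<sigma> n $ k $ i $ j)" for k i j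
    using entry[of "(k, i)" "(z, j)"] by (simp add: bcirc_first_column[OF z] Cauchy_convergent_iff)
  have "\<sigma> \<longlonglongrightarrow> (\<chi> k i j. lim (\<lambda>n. \<sigma> n $ k $ i $ j))"
    by (intro vec_tendstoI) (use conv in \<open>simp add: convergent_LIMSEQ_iff\<close>)
  then show thesis by (rule that)
qed

text \<open>
  Positive definiteness survives in the limit because the forms stay away from zero: each late form
  differs from the limit by at most half of itself.  The relative closeness of forms also passes to the
  limit, and bounds the distance along the segment to it.
\<close>

lemma riem_MCauchy_limit:
  fixes \<sigma> :: "nat \<Rightarrow> complex^'n^'n^'p::{finite,linorder}"
  assumes "Metric_space.MCauchy T_pos_def riem_dist \<sigma>" and lim: "\<sigma> \<longlonglongrightarrow> A"
  shows "A \<in> T_pos_def" and "0 < e \<Longrightarrow> \<exists>N. \<forall>n\<ge>N. riem_dist (\<sigma> n) A < e"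
proof -
  have T: "\<sigma> n \<in> T_pos_def" for n
    using assms(1)[unfolded Metric_space.MCauchy_def[OF Metric_space_riem_dist]] by auto
  have limb: "(\<lambda>n. bcirc (\<sigma> n)) \<longlonglongrightarrow> bcirc A"
    by (rule bounded_linear.tendsto[OF bounded_linear_bcirc lim])
  have limq: "(\<lambda>n. qform (bcirc (\<sigma> n)) x) \<longlonglongrightarrow> qform (bcirc A) x" for x
    by (rule bounded_linear.tendsto[OF bounded_linear_qform limb])
  have near: "\<exists>N. \<forall>n\<ge>N. \<forall>x. \<bar>qform (bcirc (\<sigma> n)) x - qform (bcirc A) x\<bar> \<le> \<eta> * qform (bcirc (\<sigma> n)) x \<and>
      \<bar>qform (bcirc (\<sigma> n)) x - qform (bcirc A) x\<bar> \<le> \<eta> * qform (bcirc A) x" if \<eta>: "0 < \<eta>" for \<eta>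
  proof -
    obtain N where N: "\<And>m n x. N \<le> m \<Longrightarrow> N \<le> n \<Longrightarrow>
        \<bar>qform (bcirc (\<sigma> m)) x - qform (bcirc (\<sigma> n)) x\<bar> \<le> \<eta> * qform (bcirc (\<sigma> m)) x"
      using riem_MCauchy_qform[OF assms(1) \<eta>] by blast
    have "\<bar>qform (bcirc (\<sigma> n)) x - qform (bcirc A) x\<bar> \<le> \<eta> * qform (bcirc (\<sigma> n)) x"
      if "N \<le> n" for n x
    proof (rule LIMSEQ_le_const2)
      show "(\<lambda>m. \<bar>qform (bcirc (\<sigma> n)) x - qform (bcirc (\<sigma> m)) x\<bar>) \<longlonglongrightarrow> \<bar>qform (bcirc (\<sigma> n)) x - qform (bcirc A) x\<bar>"
        by (intro tendsto_intros limq)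
    qed (use N that in blast)
    moreover have "\<bar>qform (bcirc (\<sigma> n)) x - qform (bcirc A) x\<bar> \<le> \<eta> * qform (bcirc A) x"
      if "N \<le> n" for n x
    proof (rule LIMSEQ_le)
      show "(\<lambda>m. \<bar>qform (bcirc (\<sigma> n)) x - qform (bcirc (\<sigma> m)) x\<bar>) \<longlonglongrightarrow> \<bar>qform (bcirc (\<sigma> n)) x - qform (bcirc A) x\<bar>"
        "(\<lambda>m. \<eta> * qform (bcirc (\<sigma> m)) x) \<longlonglongrightarrow> \<eta> * qform (bcirc A) x"
        by (intro tendsto_intros limq)+
    qed (use N that in \<open>metis abs_minus_commute\<close>)
    ultimately show ?thesis by blast
  qed
  have "(\<lambda>n. conj_transpose (bcirc (\<sigma> n))) \<longlonglongrightarrow> conj_transpose (bcirc A)"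
    by (rule bounded_linear.tendsto[OF bounded_linear_conj_transpose limb])
  then have "(\<lambda>n. bcirc (\<sigma> n)) \<longlonglongrightarrow> conj_transpose (bcirc A)"
    using T by (simp add: T_pos_def_iff pos_def_def hermitian_def)
  then have "hermitian (bcirc A)"
    unfolding hermitian_def using limb by (rule LIMSEQ_unique)
  moreover have "0 < qform (bcirc A) x" if "x \<noteq> 0" for x
  proof -
    obtain N where "\<bar>qform (bcirc (\<sigma> N)) x - qform (bcirc A) x\<bar> \<le> (1/2) * qform (bcirc (\<sigma> N)) x"
      using near[of "1/2"] by auto
    with T_pos_def_qform_pos[OF T that, of N] show ?thesis by linarith
  qed
  ultimately show A: "A \<in> T_pos_def"
    by (simp add: T_pos_def_iff pos_def_def)
  assume "0 < e"
  define \<eta> where "\<eta> = e / (2 * CARD('p \<times> 'n))"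
  have "0 < \<eta>" and le: "CARD('p \<times> 'n) * \<eta> < e"
    using \<open>0 < e\<close> by (auto simp: \<eta>_def field_simps)
  from near[OF \<open>0 < \<eta>\<close>] obtain N where N:
    "\<And>n x. N \<le> n \<Longrightarrow> \<bar>qform (bcirc (\<sigma> n)) x - qform (bcirc A) x\<bar> \<le> \<eta> * qform (bcirc (\<sigma> n)) x"
    "\<And>n x. N \<le> n \<Longrightarrow> \<bar>qform (bcirc (\<sigma> n)) x - qform (bcirc A) x\<bar> \<le> \<eta> * qform (bcirc A) x"
    by blast
  have "riem_dist (\<sigma> n) A < e" if "N \<le> n" for n
  proof -
    have "riem_dist A (\<sigma> n) \<le> CARD('p \<times> 'n) * \<eta>"
      by (rule riem_dist_le_of_qform[OF A T N(2)[OF that] N(1)[OF that]])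
    with le show ?thesis by (simp add: riem_dist_commute[of "\<sigma> n" A])
  qed
  then show "\<exists>N. \<forall>n\<ge>N. riem_dist (\<sigma> n) A < e" by blast
qed

theorem theorem4p2:
  shows "Metric_space (T_pos_def :: (complex^'n^'n^'p::{finite,linorder}) set) riem_dist \<and>
    Metric_space.mcomplete (T_pos_def :: (complex^'n^'n^'p::{finite,linorder}) set) riem_dist"
proof
  show ms: "Metric_space (T_pos_def :: (complex^'n^'n^'p::{finite,linorder}) set) riem_dist"
    by (rule Metric_space_riem_dist)
  show "Metric_space.mcomplete (T_pos_def :: (complex^'n^'n^'p::{finite,linorder}) set) riem_dist"
    unfolding Metric_space.mcomplete_def[OF ms]
  proof (intro allI impI)
    fix \<sigma> :: "nat \<Rightarrow> complex^'n^'n^'p::{finite,linorder}"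
    assume C: "Metric_space.MCauchy T_pos_def riem_dist \<sigma>"
    obtain A where A: "\<sigma> \<longlonglongrightarrow> A" using riem_MCauchy_convergent[OF C] .
    have "\<sigma> n \<in> T_pos_def" for n
      using C[unfolded Metric_space.MCauchy_def[OF ms]] by auto
    with riem_MCauchy_limit[OF C A]
    have "limitin (Metric_space.mtopology T_pos_def riem_dist) \<sigma> A sequentially"
      unfolding Metric_space.limit_metric_sequentially[OF ms] by blast
    then show "\<exists>A. limitin (Metric_space.mtopology T_pos_def riem_dist) \<sigma> A sequentially" ..
  qed
qed

end
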